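(* Let $n\ge 1$, $A\in\mathbb{R}^{n\times n}$, $k\in\{1,\dots,n\}$, $p\in\{1,2,\infty\}$, let $q$ satisfy $p^{-1}+q^{-1}=1$, and let $T\in\mathbb{R}^{n\times n}$ be invertible. Let $$\tau_{p,k}(A):=\operatorname{tr}(A)+(n-k)\,\mu_{q,T}(-A).$$ Then $$ \mu_{p,T^{(k)}}(A^{[k]})\le \tau_{p,k}(A). $$
   Context: For $k\in\{1,\dots,n\}$, the $k$-multiplicative compound $B^{(k)}$ of an $n\times n$ matrix $B$ is the $\binom{n}{k}\times\binom{n}{k}$ matrix of all $k$-minors of $B$, with rows and columns indexed by the increasing sequences of $k$ integers from $\{1,\dots,n\}$ in lexicographic order. The $k$-additive compound is $A^{[k]}:=\frac{d}{d\varepsilon}(I_n+\varepsilon A)^{(k)}\big|_{\varepsilon=0}$. A norm $|\cdot|$ on $\mathbb{R}^m$ with induced matrix norm $\|\cdot\|$ induces the log norm $\mu(B):=\lim_{\varepsilon\downarrow0}\frac{\|I+\varepsilon B\|-1}{\varepsilon}$ on $\mathbb{R}^{m\times m}$. $\mu_p$ is the log norm induced by the $L_p$ norm, and for an invertible matrix $H$, $\mu_{p,H}(B):=\mu_p(HBH^{-1})$, which is the log norm induced by the scaled norm $|x|_{p,H}:=|Hx|_p$. The convention $1/\infty=0$ is used. *)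

theory Defs
  imports
    "HOL-Analysis.Analysis"
    "HOL-Library.List_Lexorder"
    "Jordan_Normal_Form.Determinant"
    "Jordan_Normal_Form.DL_Submatrix"
    "Jordan_Normal_Form.Gauss_Jordan_Elimination"
begin

unbundle no vec_syntax

(* Rows and columns are counted from 0, so the sequences have entries in {0, ..., n-1}. The order
   on lists used by sorted_list_of_set is the lexicographic one of List_Lexorder. *)
definition increasing_seqs :: "nat \<Rightarrow> nat \<Rightarrow> nat list list" where
  "increasing_seqs n k =
     sorted_list_of_set {I. length I = k \<and> sorted_wrt (<) I \<and> set I \<subseteq> {..<n}}"

(* submatrix selects the rows in set I and the columns in set J in increasing order, which is the
   order in which the strictly sorted lists I and J enumerate them. *)
definition mult_compound :: "nat \<Rightarrow> real mat \<Rightarrow> real mat" where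
  "mult_compound k B =
     (let rs = increasing_seqs (dim_row B) k; cs = increasing_seqs (dim_col B) k
      in mat (length rs) (length cs) (\<lambda>(i, j). Determinant.det (submatrix B (set (rs ! i)) (set (cs ! j)))))"

definition add_compound :: "nat \<Rightarrow> real mat \<Rightarrow> real mat" where
  "add_compound k A =
     (let M = (\<lambda>\<epsilon>. mult_compound k (1\<^sub>m (dim_row A) + \<epsilon> \<cdot>\<^sub>m A))
      in mat (dim_row (M 0)) (dim_col (M 0)) (\<lambda>(i, j). deriv (\<lambda>\<epsilon>. M \<epsilon> $$ (i, j)) 0))"

definition trace_mat :: "real mat \<Rightarrow> real" where
  "trace_mat A = (\<Sum>i<dim_row A. A $$ (i, i))"

(* Meant for 1 \<le> p. The inserted 0 only matters for vectors of dimension 0. *)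
definition lp_norm :: "ennreal \<Rightarrow> real vec \<Rightarrow> real" where
  "lp_norm p x =
     (if p = \<infinity> then Max (insert 0 ((\<lambda>i. \<bar>x $ i\<bar>) ` {..<dim_vec x}))
      else (\<Sum>i<dim_vec x. \<bar>x $ i\<bar> powr enn2real p) powr (1 / enn2real p))"

definition induced_norm :: "(real vec \<Rightarrow> real) \<Rightarrow> real mat \<Rightarrow> real" where
  "induced_norm N B =
     (SUP x \<in> carrier_vec (dim_col B) - {0\<^sub>v (dim_col B)}. N (B *\<^sub>v x) / N x)"

definition log_norm :: "(real vec \<Rightarrow> real) \<Rightarrow> real mat \<Rightarrow> real" where
  "log_norm N B =
     Lim (at_right 0) (\<lambda>\<epsilon>. (induced_norm N (1\<^sub>m (dim_row B) + \<epsilon> \<cdot>\<^sub>m B) - 1) / \<epsilon>)"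

definition scaled_log_norm :: "ennreal \<Rightarrow> real mat \<Rightarrow> real mat \<Rightarrow> real" where
  "scaled_log_norm p H B = log_norm (lp_norm p) (H * B * the (mat_inverse H))"

lemma finite_increasing_seqs:
  "finite {I. length I = k \<and> sorted_wrt (<) I \<and> set I \<subseteq> {..<n::nat}}"
  by (rule finite_subset[OF _ finite_lists_length_eq[of "{..<n}" k]]) auto

lemma set_increasing_seqs:
  "set (increasing_seqs n k) = {I. length I = k \<and> sorted_wrt (<) I \<and> set I \<subseteq> {..<n}}"
  by (simp add: increasing_seqs_def finite_increasing_seqs)

lemma length_increasing_seqs: "length (increasing_seqs n k) = n choose k"
proof -
  let ?S = "{I. length I = k \<and> sorted_wrt (<) I \<and> set I \<subseteq> {..<n}}"
  have "bij_betw set ?S {K. K \<subseteq> {..<n} \<and> card K = k}"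
  proof (rule bij_betw_imageI)
    show "inj_on set ?S"
      by (auto intro!: inj_onI strict_sorted_equal)
    show "set ` ?S = {K. K \<subseteq> {..<n} \<and> card K = k}"
    proof (intro equalityI subsetI)
      fix K assume "K \<in> {K. K \<subseteq> {..<n} \<and> card K = k}"
      then have K: "K \<subseteq> {..<n}" "card K = k" "finite K"
        by (auto intro: finite_subset)
      then have "sorted_list_of_set K \<in> ?S" "set (sorted_list_of_set K) = K"
        by auto
      then show "K \<in> set ` ?S" by (metis imageI)
    qed (auto simp: distinct_card strict_sorted_iff)
  qed
  then have "card ?S = n choose k"
    by (simp add: bij_betw_same_card n_subsets)
  then show ?thesis
    by (simp add: increasing_seqs_def)
qed

lemma mult_compound_carrier:
  assumes "B \<in> carrier_mat n n"
  shows "mult_compound k B \<in> carrier_mat (n choose k) (n choose k)"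
  using assms by (auto simp: mult_compound_def length_increasing_seqs Let_def)

lemma add_compound_carrier:
  assumes "A \<in> carrier_mat n n"
  shows "add_compound k A \<in> carrier_mat (n choose k) (n choose k)"
  using assms by (auto simp: add_compound_def mult_compound_def length_increasing_seqs Let_def)

(* Every entry is a polynomial in \<epsilon>, so deriv in add_compound is a genuine derivative. *)
lemma mult_compound_entry_differentiable:
  assumes A: "A \<in> carrier_mat n n" and i: "i < n choose k" and j: "j < n choose k"
  shows "(\<lambda>\<epsilon>. mult_compound k (1\<^sub>m n + \<epsilon> \<cdot>\<^sub>m A) $$ (i, j)) field_differentiable (at x)"
proof -
  define R where "R = increasing_seqs n k ! i"
  define C where "C = increasing_seqs n k ! j"
  have RC: "R \<in> set (increasing_seqs n k)" "C \<in> set (increasing_seqs n k)"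
    using i j by (simp_all add: R_def C_def length_increasing_seqs)
  have setcard: "{a. a < n \<and> a \<in> set I} = set I" "card (set I) = k"
    if "I \<in> set (increasing_seqs n k)" for I
    using that by (auto simp: set_increasing_seqs strict_sorted_iff distinct_card)
  have pick_less: "pick (set I) a < n" if "I \<in> set (increasing_seqs n k)" "a < k" for I a
    using pick_in_set[of a "set I"] that setcard[OF that(1)]
    by (auto simp: set_increasing_seqs)
  have "mult_compound k (1\<^sub>m n + e \<cdot>\<^sub>m A) $$ (i, j) =
      (\<Sum>p | p permutes {0..<k}. signof p *
         (\<Prod>a = 0..<k. (if pick (set R) a = pick (set C) (p a) then 1 else 0)
            + e * A $$ (pick (set R) a, pick (set C) (p a))))" for e
  proof -
    have "mult_compound k (1\<^sub>m n + e \<cdot>\<^sub>m A) $$ (i, j) =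
        Determinant.det (mat k k (\<lambda>(a, b). (1\<^sub>m n + e \<cdot>\<^sub>m A) $$ (pick (set R) a, pick (set C) b)))"
      using A i j setcard[OF RC(1)] setcard[OF RC(2)]
      by (simp add: mult_compound_def length_increasing_seqs Let_def submatrix_def
          flip: R_def C_def)
    also have "\<dots> = (\<Sum>p | p permutes {0..<k}. signof p *
        (\<Prod>a = 0..<k. (1\<^sub>m n + e \<cdot>\<^sub>m A) $$ (pick (set R) a, pick (set C) (p a))))"
      by (auto simp: Determinant.det_def intro!: sum.cong prod.cong
          dest: permutes_in_image[of _ "{0..<k}"])
    also have "\<dots> = (\<Sum>p | p permutes {0..<k}. signof p *
         (\<Prod>a = 0..<k. (if pick (set R) a = pick (set C) (p a) then 1 else 0)
            + e * A $$ (pick (set R) a, pick (set C) (p a))))"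
    proof (intro sum.cong refl arg_cong2[of _ _ _ _ "(*)"] prod.cong)
      fix p a assume p: "p \<in> {p. p permutes {0..<k}}" and a: "a \<in> {0..<k}"
      then have "p a < k" using permutes_in_image[of p "{0..<k}" a] by auto
      then have "pick (set R) a < n" "pick (set C) (p a) < n"
        using a pick_less RC by auto
      then show "(1\<^sub>m n + e \<cdot>\<^sub>m A) $$ (pick (set R) a, pick (set C) (p a)) =
        (if pick (set R) a = pick (set C) (p a) then 1 else 0)
            + e * A $$ (pick (set R) a, pick (set C) (p a))"
        using A by auto
    qed
    finally show ?thesis .
  qed
  moreover have "(\<lambda>e. \<Prod>a\<in>S. c a + e * d a) field_differentiable (at x)"
    if "finite S" for S :: "nat set" and c d :: "nat \<Rightarrow> real"
    using that
    by induction (auto intro!: field_differentiable_mult field_differentiable_add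
        field_differentiable_const field_differentiable_ident)
  ultimately show ?thesis
    by (simp add: field_differentiable_sum field_differentiable_mult field_differentiable_const
        finite_atLeastLessThan)
qed

lemma mat_inverse_invertible:
  assumes H: "H \<in> carrier_mat n n" and "invertible_mat (H :: real mat)"
  shows "the (mat_inverse H) \<in> carrier_mat n n"
    and "H * the (mat_inverse H) = 1\<^sub>m n" and "the (mat_inverse H) * H = 1\<^sub>m n"
proof -
  obtain B where B: "H * B = 1\<^sub>m n" "B * H = 1\<^sub>m (dim_row B)"
    using assms by (auto simp: invertible_mat_def inverts_mat_def)
  have "dim_col B = n" using arg_cong[OF B(1), of dim_col] by simp
  moreover have "dim_row B = n" using arg_cong[OF B(2), of dim_col] H by simp
  ultimately have "H \<in> Units (ring_mat TYPE(real) n ())"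
    using B H by (auto simp: Units_def ring_mat_def intro!: bexI[of _ B])
  then obtain C where "mat_inverse H = Some C"
    using mat_inverse(1)[OF H] by fastforce
  then show "the (mat_inverse H) \<in> carrier_mat n n"
    "H * the (mat_inverse H) = 1\<^sub>m n" "the (mat_inverse H) * H = 1\<^sub>m n"
    using mat_inverse(2)[OF H] by auto
qed

end

theory Submission
  imports Defs
begin

unbundle no inner_syntax

text \<open>
  Put C = T A T^-1. The Cauchy-Binet formula makes the multiplicative compound multiplicative, so the
  left-hand side is the log norm of the k-additive compound of C, and it suffices to treat T = I.

  For p = 1 the log norm of a matrix is the maximum over the columns of the diagonal entry plus the
  absolute values of the other entries. In the column of the k-additive compound with index set R
  this is at most the sum of the c_jj with j in R plus the sum of the |c_ij| with i outside R and
  j in R, which is tr C plus the sum over i outside R of -c_ii + \<Sum>_{j in R} |c_ij|; each of these n - k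
  terms is at most the log norm of -C for the maximum norm. The case p = \<infinity> follows by transposition.

  For p = 2 let a_i^* and a_i be the creation and annihilation operators on the exterior algebra, so
  that the k-additive compound is \<Sum> c_ij a_i^* a_j. The relation a_i^* a_j + a_j a_i^* = \<delta>_ij gives
  <x, C^[k] x> + \<Sum> c_ij <a_j^* x, a_i^* x> = tr(C) |x|^2. The second sum splits over the index sets D
  of size k+1 into quadratic forms of C, hence is at least -\<mu>(-C) times the sum of the |a_i^* x|^2, and
  the latter sum is (n - k) |x|^2.
\<close>

section \<open>Log norms\<close>

text \<open>One \<open>N\<close> covers vectors of all dimensions. The last two axioms place it
  between the maximum and the sum of the absolute coordinates: the lower bound makes
  \<open>N\<close> definite, and both together make every matrix a bounded operator, so that the
  supremum in \<open>induced_norm\<close> is genuine.\<close>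

locale coordinate_norm =
  fixes N :: "real vec \<Rightarrow> real"
  assumes triangle: "dim_vec x = dim_vec y \<Longrightarrow> N (x + y) \<le> N x + N y"
    and smult: "N (c \<cdot>\<^sub>v x) = \<bar>c\<bar> * N x"
    and entry_le: "i < dim_vec x \<Longrightarrow> \<bar>x $ i\<bar> \<le> N x"
    and le_sum: "N x \<le> (\<Sum>i<dim_vec x. \<bar>x $ i\<bar>)"
begin

lemma nonneg: "0 \<le> N x"
proof -
  have "0 \<cdot>\<^sub>v x = x + (-1) \<cdot>\<^sub>v x" by auto
  then have "N (0 \<cdot>\<^sub>v x) \<le> N x + N ((-1) \<cdot>\<^sub>v x)" using triangle[of x "(-1) \<cdot>\<^sub>v x"] by simp
  then show ?thesis by (simp add: smult)
qed

lemma pos: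
  assumes "x \<in> carrier_vec m" "x \<noteq> 0\<^sub>v m" shows "0 < N x"
proof -
  obtain i where "i < m" "x $ i \<noteq> 0" using assms by (metis carrier_vecD eq_vecI index_zero_vec)
  then show ?thesis using entry_le[of i x] assms by auto
qed

lemma mult_mat_vec_bound:
  assumes B: "B \<in> carrier_mat r m"
  obtains K where "\<And>x. x \<in> carrier_vec m \<Longrightarrow> N (B *\<^sub>v x) \<le> K * N x"
proof
  fix x :: "real vec" assume x: "x \<in> carrier_vec m"
  have "N (B *\<^sub>v x) \<le> (\<Sum>i<r. \<bar>\<Sum>j<m. B $$ (i, j) * x $ j\<bar>)"
    using le_sum[of "B *\<^sub>v x"] B x by (simp add: scalar_prod_def atLeast0LessThan)
  also have "\<dots> \<le> (\<Sum>i<r. \<Sum>j<m. \<bar>B $$ (i, j)\<bar> * N x)"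
    using x entry_le by (intro sum_mono sum_abs[THEN order_trans]) (auto simp: abs_mult intro!: mult_left_mono)
  finally show "N (B *\<^sub>v x) \<le> (\<Sum>i<r. \<Sum>j<m. \<bar>B $$ (i, j)\<bar>) * N x"
    by (simp add: sum_distrib_right)
qed

lemma induced_norm_le:
  assumes B: "B \<in> carrier_mat r m" and m: "0 < m"
    and K: "\<And>x. x \<in> carrier_vec m \<Longrightarrow> N (B *\<^sub>v x) \<le> K * N x"
  shows "induced_norm N B \<le> K"
  unfolding induced_norm_def
proof (rule cSUP_least)
  \<comment> \<open>In dimension 0 the supremum would range over the empty set; here
    \<open>0 < m\<close> enters.\<close>
  have "unit_vec m 0 \<in> carrier_vec m - {0\<^sub>v m :: real vec}"
    using m by (auto dest!: arg_cong[of _ _ "\<lambda>v. v $ 0"])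
  then show "carrier_vec (dim_col B) - {0\<^sub>v (dim_col B)} \<noteq> ({} :: real vec set)" using B by (metis carrier_matD(2) empty_iff)
next
  fix x :: "real vec" assume "x \<in> carrier_vec (dim_col B) - {0\<^sub>v (dim_col B)}"
  then show "N (B *\<^sub>v x) / N x \<le> K"
    using K[of x] pos[of x m] B by (simp add: divide_le_eq)
qed

lemma le_induced_norm:
  assumes B: "B \<in> carrier_mat r m" and x: "x \<in> carrier_vec m"
  shows "N (B *\<^sub>v x) \<le> induced_norm N B * N x"
proof (cases "x = 0\<^sub>v m")
  case True
  \<comment> \<open>Homogeneity with the factor 0 makes both norms vanish.\<close>
  then have "x = 0 \<cdot>\<^sub>v x" by auto
  moreover have "B *\<^sub>v x = 0 \<cdot>\<^sub>v (B *\<^sub>v x)" using True B by auto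
  ultimately have "N (B *\<^sub>v x) = 0" "N x = 0" by (metis abs_zero mult_zero_left smult)+
  then show ?thesis by simp
next
  case False
  obtain K where K: "\<And>x. x \<in> carrier_vec m \<Longrightarrow> N (B *\<^sub>v x) \<le> K * N x"
    using mult_mat_vec_bound[OF B] by blast
  have "N (B *\<^sub>v x) / N x \<le> induced_norm N B"
    unfolding induced_norm_def
  proof (rule cSUP_upper)
    show "bdd_above ((\<lambda>x. N (B *\<^sub>v x) / N x) ` (carrier_vec (dim_col B) - {0\<^sub>v (dim_col B)}))"
      using K pos[of _ m] B by (intro bdd_aboveI[of _ K]) (fastforce simp: divide_le_eq)
  qed (use False B x in auto)
  then show ?thesis using pos[OF x False] by (simp add: divide_le_eq)
qed

end

section \<open>Existence of the log norm, and criteria for bounding it\<close>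

lemma one_plus_smult_mult_vec:
  fixes B :: "real mat"
  assumes "B \<in> carrier_mat m m" "x \<in> carrier_vec m"
  shows "(1\<^sub>m m + e \<cdot>\<^sub>m B) *\<^sub>v x = x + e \<cdot>\<^sub>v (B *\<^sub>v x)"
  using assms by (subst add_mult_distrib_mat_vec[of _ m m]) auto

context coordinate_norm
begin

(* The difference quotient is monotone in e, by convexity, and bounded below; so the Lim in
   log_norm is never the junk value of a divergent limit. *)
lemma log_norm_tendsto:
  assumes B: "B \<in> carrier_mat m m" and m: "0 < m"
  shows "((\<lambda>e. (induced_norm N (1\<^sub>m m + e \<cdot>\<^sub>m B) - 1) / e) \<longlongrightarrow> log_norm N B) (at_right 0)"
proof -
  define h where "h e = induced_norm N (1\<^sub>m m + e \<cdot>\<^sub>m B)" for e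
  have C: "1\<^sub>m m + e \<cdot>\<^sub>m B \<in> carrier_mat m m" for e using B by simp
  have hx: "N (x + e \<cdot>\<^sub>v (B *\<^sub>v x)) \<le> h e * N x" if "x \<in> carrier_vec m" for e x
    using le_induced_norm[OF C that, of e] one_plus_smult_mult_vec[OF B that, of e]
    by (simp add: h_def)
  \<comment> \<open>Convexity: x + s B x is the convex combination of x and x + t B x with weights 1
    - s/t and s/t.\<close>
  have mono: "(h s - 1) / s \<le> (h t - 1) / t" if st: "0 < s" "s \<le> t" for s t
  proof -
    have "h s \<le> 1 - s / t + s / t * h t"
      unfolding h_def[of s]
    proof (rule induced_norm_le[OF C m])
      fix x :: "real vec" assume x: "x \<in> carrier_vec m"
      have "x + s \<cdot>\<^sub>v (B *\<^sub>v x) = (1 - s / t) \<cdot>\<^sub>v x + (s / t) \<cdot>\<^sub>v (x + t \<cdot>\<^sub>v (B *\<^sub>v x))"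
        using B x st by (intro eq_vecI) (auto simp: field_simps)
      also have "N \<dots> \<le> N ((1 - s / t) \<cdot>\<^sub>v x) + N ((s / t) \<cdot>\<^sub>v (x + t \<cdot>\<^sub>v (B *\<^sub>v x)))"
        using B x by (intro triangle) auto
      also have "\<dots> = (1 - s / t) * N x + s / t * N (x + t \<cdot>\<^sub>v (B *\<^sub>v x))"
        using st by (simp add: smult)
      also have "\<dots> \<le> (1 - s / t) * N x + s / t * (h t * N x)"
        using hx[OF x, of t] st by (intro add_left_mono mult_left_mono) auto
      finally show "N ((1\<^sub>m m + s \<cdot>\<^sub>m B) *\<^sub>v x) \<le> (1 - s / t + s / t * h t) * N x"
        using one_plus_smult_mult_vec[OF B x, of s] by (simp add: algebra_simps)
    qed
    then have "h s - 1 \<le> s * ((h t - 1) / t)" using st by (simp add: algebra_simps diff_divide_distrib)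
    then show ?thesis using st by (simp add: divide_le_eq mult.commute)
  qed
  obtain K where K: "\<And>x. x \<in> carrier_vec m \<Longrightarrow> N (B *\<^sub>v x) \<le> K * N x"
    using mult_mat_vec_bound[OF B] by blast
  \<comment> \<open>For one nonzero vector u, the triangle inequality gives N u \<le> (h e + e K) N
    u, and N u cancels.\<close>
  have low: "- K \<le> (h e - 1) / e" if "0 < e" for e
  proof -
    define u :: "real vec" where "u = unit_vec m 0"
    have u: "u \<in> carrier_vec m" and "u \<noteq> 0\<^sub>v m" using m by (auto simp: u_def dest!: arg_cong[of _ _ "\<lambda>v. v $ 0"])
    then have up: "0 < N u" by (rule pos)
    have "u = (u + e \<cdot>\<^sub>v (B *\<^sub>v u)) + (- e) \<cdot>\<^sub>v (B *\<^sub>v u)" using u B by (intro eq_vecI) auto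
    then have "N u \<le> N (u + e \<cdot>\<^sub>v (B *\<^sub>v u)) + N ((- e) \<cdot>\<^sub>v (B *\<^sub>v u))"
      using triangle[of "u + e \<cdot>\<^sub>v (B *\<^sub>v u)" "(- e) \<cdot>\<^sub>v (B *\<^sub>v u)"] u B by simp
    also have "\<dots> \<le> h e * N u + e * (K * N u)"
      using hx[OF u, of e] K[OF u] that by (intro add_mono) (auto simp: smult)
    finally have "1 * N u \<le> (h e + e * K) * N u" by (simp add: algebra_simps)
    then have "1 \<le> h e + e * K" using up mult_right_le_imp_le by blast
    then show ?thesis using that by (simp add: field_simps)
  qed
  \<comment> \<open>A nondecreasing function of e that is bounded below tends to its infimum as e
    decreases to 0.\<close>
  define L where "L = (INF e\<in>{0<..}. (h e - 1) / e)"
  have "((\<lambda>e. (h e - 1) / e) \<longlongrightarrow> L) (at_right 0)"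
  proof (rule order_tendstoI)
    fix a assume "a < L"
    then have "a < (h e - 1) / e" if "0 < e" for e
    proof -
      have "L \<le> (h e - 1) / e" unfolding L_def
        using that low by (intro cINF_lower bdd_belowI[of _ "-K"]) auto
      then show ?thesis using \<open>a < L\<close> by simp
    qed
    then show "\<forall>\<^sub>F e in at_right 0. a < (h e - 1) / e"
      by (auto simp: eventually_at_right_less eventually_at_right_field intro: exI[of _ 1])
  next
    fix a assume "L < a"
    then obtain t where t: "0 < t" "(h t - 1) / t < a"
      unfolding L_def using low by (subst (asm) cINF_less_iff) (auto intro!: bdd_belowI[of _ "-K"])
    have "(h e - 1) / e < a" if "0 < e" "e < t" for e
      using mono[of e t] that t(2) by auto
    then show "\<forall>\<^sub>F e in at_right 0. (h e - 1) / e < a"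
      using t(1) by (auto simp: eventually_at_right_field)
  qed
  moreover from this have "log_norm N B = L"
    unfolding log_norm_def using B by (auto intro!: tendsto_Lim simp: h_def)
  ultimately show ?thesis by (simp add: h_def)
qed

text \<open>The term with \<open>K\<close> leaves room for an error of second order, which vanishes
  after division by e in the limit. The Euclidean norm needs it, since there only the square of the
  norm is computed; the other two norms take K = 0.\<close>

lemma log_norm_le:
  assumes B: "B \<in> carrier_mat m m" and m: "0 < m"
    and ev: "\<forall>\<^sub>F e in at_right 0. \<forall>x\<in>carrier_vec m.
      N ((1\<^sub>m m + e \<cdot>\<^sub>m B) *\<^sub>v x) \<le> (1 + e * c + e\<^sup>2 * K) * N x"
  shows "log_norm N B \<le> c"
proof (rule tendsto_le[OF _ _ log_norm_tendsto[OF B m]])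
  show "((\<lambda>e. c + e * K) \<longlongrightarrow> c) (at_right 0)"
    by (auto intro!: tendsto_eq_intros)
  show "\<forall>\<^sub>F e in at_right 0. (induced_norm N (1\<^sub>m m + e \<cdot>\<^sub>m B) - 1) / e \<le> c + e * K"
    using ev eventually_at_right_less[of 0]
  proof eventually_elim
    case (elim e)
    then have "induced_norm N (1\<^sub>m m + e \<cdot>\<^sub>m B) \<le> 1 + e * c + e\<^sup>2 * K"
      using B m by (intro induced_norm_le[of _ m m]) auto
    then show ?case using elim by (simp add: field_simps power2_eq_square)
  qed
qed simp

lemma log_norm_ge:
  assumes B: "B \<in> carrier_mat m m" and m: "0 < m"
    and ge: "\<And>e. 0 < e \<Longrightarrow> 1 + e * c \<le> induced_norm N (1\<^sub>m m + e \<cdot>\<^sub>m B)"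
  shows "c \<le> log_norm N B"
proof (rule tendsto_lowerbound[OF log_norm_tendsto[OF B m]])
  show "\<forall>\<^sub>F e in at_right 0. c \<le> (induced_norm N (1\<^sub>m m + e \<cdot>\<^sub>m B) - 1) / e"
    using eventually_at_right_less[of 0]
  proof eventually_elim
    case (elim e) then show ?case using ge[of e] by (simp add: field_simps)
  qed
qed simp

end

section \<open>The L1, L2 and maximum norms as instances\<close>

lemma lp_norm_1: "lp_norm 1 x = (\<Sum>i<dim_vec x. \<bar>x $ i\<bar>)"
  by (simp add: lp_norm_def sum_nonneg)

lemma lp_norm_2: "lp_norm 2 x = L2_set (($) x) {..<dim_vec x}"
  by (simp add: lp_norm_def L2_set_def powr_half_sqrt sum_nonneg)

lemma lp_norm_inf_le_iff: "lp_norm Orderings.top x \<le> c \<longleftrightarrow> 0 \<le> c \<and> (\<forall>i<dim_vec x. \<bar>x $ i\<bar> \<le> c)"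
  by (auto simp: lp_norm_def)

lemma entry_le_lp_norm_inf: "i < dim_vec x \<Longrightarrow> \<bar>x $ i\<bar> \<le> lp_norm Orderings.top x"
  by (auto simp: lp_norm_def intro!: Max_ge)

interpretation lp1: coordinate_norm "lp_norm 1"
proof
  fix x y :: "real vec" and c :: real and i
  show "lp_norm 1 (x + y) \<le> lp_norm 1 x + lp_norm 1 y" if "dim_vec x = dim_vec y"
    using that by (auto simp: lp_norm_1 simp flip: sum.distrib intro!: sum_mono)
  show "lp_norm 1 (c \<cdot>\<^sub>v x) = \<bar>c\<bar> * lp_norm 1 x"
    by (simp add: lp_norm_1 abs_mult sum_distrib_left)
  show "\<bar>x $ i\<bar> \<le> lp_norm 1 x" if "i < dim_vec x"
    using that unfolding lp_norm_1 by (intro member_le_sum) auto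
qed (simp add: lp_norm_1)

interpretation lp2: coordinate_norm "lp_norm 2"
proof
  fix x y :: "real vec" and c :: real and i
  show "lp_norm 2 (x + y) \<le> lp_norm 2 x + lp_norm 2 y" if "dim_vec x = dim_vec y"
    using that L2_set_triangle_ineq[of "($) x" "($) y" "{..<dim_vec y}"]
    by (simp add: lp_norm_2 L2_set_def)
  \<comment> \<open>The squares do not see the sign of c, and the nonnegative factor \<bar>c\<bar>
    can be pulled out of \<open>L2_set\<close>.\<close>
  have "L2_set (($) (c \<cdot>\<^sub>v x)) {..<dim_vec x} = L2_set (\<lambda>i. \<bar>c\<bar> * x $ i) {..<dim_vec x}"
    by (simp add: L2_set_def power_mult_distrib)
  then show "lp_norm 2 (c \<cdot>\<^sub>v x) = \<bar>c\<bar> * lp_norm 2 x"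
    by (simp add: lp_norm_2 L2_set_right_distrib)
  show "\<bar>x $ i\<bar> \<le> lp_norm 2 x" if "i < dim_vec x"
    using that member_le_L2_set[of "{..<dim_vec x}" i "\<lambda>i. \<bar>x $ i\<bar>"]
    by (simp add: lp_norm_2 L2_set_def)
  show "lp_norm 2 x \<le> (\<Sum>i<dim_vec x. \<bar>x $ i\<bar>)"
    by (simp add: lp_norm_2 L2_set_le_sum_abs)
qed

interpretation lp_inf: coordinate_norm "lp_norm Orderings.top"
proof
  have nn: "0 \<le> lp_norm Orderings.top x" for x by (simp add: lp_norm_def)
  fix x y :: "real vec" and c :: real and i
  show "lp_norm Orderings.top (x + y) \<le> lp_norm Orderings.top x + lp_norm Orderings.top y" if "dim_vec x = dim_vec y"
    using that unfolding lp_norm_inf_le_iff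
    by (auto simp: nn intro!: order_trans[OF abs_triangle_ineq] add_mono entry_le_lp_norm_inf)
  have le: "lp_norm Orderings.top (c \<cdot>\<^sub>v x) \<le> \<bar>c\<bar> * lp_norm Orderings.top x" for c x
    unfolding lp_norm_inf_le_iff
    by (auto simp: nn abs_mult intro!: mult_left_mono entry_le_lp_norm_inf)
  \<comment> \<open>The converse inequality is \<open>le\<close> for the factor
    \<open>inverse c\<close> and the vector c x.\<close>
  have "\<bar>c\<bar> * lp_norm Orderings.top x \<le> lp_norm Orderings.top (c \<cdot>\<^sub>v x)"
  proof (cases "c = 0")
    case False
    have "lp_norm Orderings.top x \<le> \<bar>inverse c\<bar> * lp_norm Orderings.top (c \<cdot>\<^sub>v x)"
      using le[of "inverse c" "c \<cdot>\<^sub>v x"] False by (simp add: smult_smult_assoc)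
    then show ?thesis using False by (simp add: field_simps)
  qed (simp add: nn)
  with le[of c x] show "lp_norm Orderings.top (c \<cdot>\<^sub>v x) = \<bar>c\<bar> * lp_norm Orderings.top x" by simp
  show "\<bar>x $ i\<bar> \<le> lp_norm Orderings.top x" if "i < dim_vec x" using that by (rule entry_le_lp_norm_inf)
  show "lp_norm Orderings.top x \<le> (\<Sum>i<dim_vec x. \<bar>x $ i\<bar>)"
    unfolding lp_norm_inf_le_iff by (auto intro!: sum_nonneg member_le_sum)
qed

section \<open>Column and row sums for the L1 and maximum norms\<close>

lemma one_plus_smult_mult_vec_index:
  fixes B :: "real mat"
  assumes "B \<in> carrier_mat m m" "x \<in> carrier_vec m" "i < m"
  shows "((1\<^sub>m m + e \<cdot>\<^sub>m B) *\<^sub>v x) $ i = (\<Sum>j<m. ((if i = j then 1 else 0) + e * B $$ (i, j)) * x $ j)"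
  using assms by (auto simp: scalar_prod_def atLeast0LessThan intro!: sum.cong)

text \<open>For such e the absolute values of the diagonal entries of I + e B are affine in e, and
  hence so are all absolute row and column sums.\<close>

lemma eventually_diagonal_nonneg:
  fixes B :: "real mat"
  shows "\<forall>\<^sub>F e in at_right (0::real). 0 < e \<and> (\<forall>j<m. 0 \<le> 1 + e * B $$ (j, j))"
proof -
  have "\<forall>\<^sub>F e in at_right (0::real). 0 < 1 + e * c" for c
    by (rule order_tendstoD(1)[of _ 1]) (auto intro!: tendsto_eq_intros)
  then have "\<forall>\<^sub>F e in at_right (0::real). \<forall>j\<in>{..<m}. 0 < 1 + e * B $$ (j, j)"
    by (intro eventually_ball_finite) auto
  with eventually_at_right_less[of 0] show ?thesis
    by eventually_elim (auto intro: less_imp_le)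
qed

lemma sum_abs_one_plus:
  fixes f :: "nat \<Rightarrow> real"
  assumes "i < m" "0 < e" "0 \<le> 1 + e * f i"
  shows "(\<Sum>j<m. \<bar>(if i = j then 1 else 0) + e * f j\<bar>) = 1 + e * (f i + (\<Sum>j\<in>{..<m} - {i}. \<bar>f j\<bar>))"
proof -
  have "(\<Sum>j<m. \<bar>(if i = j then 1 else 0) + e * f j\<bar>) =
      \<bar>1 + e * f i\<bar> + (\<Sum>j\<in>{..<m} - {i}. \<bar>(if i = j then 1 else 0) + e * f j\<bar>)"
    using assms(1) by (subst sum.remove[of _ i]) auto
  also have "\<dots> = 1 + e * f i + (\<Sum>j\<in>{..<m} - {i}. e * \<bar>f j\<bar>)"
    using assms(2,3) by (intro arg_cong2[of _ _ _ _ "(+)"] sum.cong) (auto simp: abs_mult)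
  finally show ?thesis by (simp add: sum_distrib_left algebra_simps)
qed

text \<open>A bound on all absolute column sums bounds a matrix for the L1 norm. For small e the
  column sums of I + e B are 1 plus e times the left-hand side of the hypothesis.\<close>

lemma log_norm_1_le:
  assumes B: "B \<in> carrier_mat m m" and m: "0 < m"
    and c: "\<And>j. j < m \<Longrightarrow> B $$ (j, j) + (\<Sum>i\<in>{..<m} - {j}. \<bar>B $$ (i, j)\<bar>) \<le> c"
  shows "log_norm (lp_norm 1) B \<le> c"
proof (rule lp1.log_norm_le[OF B m, of _ 0])
  show "\<forall>\<^sub>F e in at_right 0. \<forall>x\<in>carrier_vec m.
      lp_norm 1 ((1\<^sub>m m + e \<cdot>\<^sub>m B) *\<^sub>v x) \<le> (1 + e * c + e\<^sup>2 * 0) * lp_norm 1 x"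
    using eventually_diagonal_nonneg[of m B]
  proof eventually_elim
    case (elim e)
    show ?case
    proof
      fix x :: "real vec" assume x: "x \<in> carrier_vec m"
      have "lp_norm 1 ((1\<^sub>m m + e \<cdot>\<^sub>m B) *\<^sub>v x) =
          (\<Sum>i<m. \<bar>\<Sum>j<m. ((if i = j then 1 else 0) + e * B $$ (i, j)) * x $ j\<bar>)"
        using B x by (simp add: lp_norm_1 one_plus_smult_mult_vec_index del: index_mult_mat_vec)
      also have "\<dots> \<le> (\<Sum>i<m. \<Sum>j<m. \<bar>(if i = j then 1 else 0) + e * B $$ (i, j)\<bar> * \<bar>x $ j\<bar>)"
        by (intro sum_mono sum_abs[THEN order_trans]) (simp add: abs_mult)
      also have "\<dots> = (\<Sum>j<m. (\<Sum>i<m. \<bar>(if j = i then 1 else 0) + e * B $$ (i, j)\<bar>) * \<bar>x $ j\<bar>)"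
        by (subst sum.swap) (auto simp: sum_distrib_right intro!: sum.cong)
      also have "\<dots> \<le> (\<Sum>j<m. (1 + e * c) * \<bar>x $ j\<bar>)"
        using elim c by (intro sum_mono mult_right_mono) (auto simp: sum_abs_one_plus[where f = "\<lambda>i. B $$ (i, _)"])
      also have "\<dots> = (1 + e * c + e\<^sup>2 * 0) * lp_norm 1 x"
        using x by (simp add: lp_norm_1 sum_distrib_left)
      finally show "lp_norm 1 ((1\<^sub>m m + e \<cdot>\<^sub>m B) *\<^sub>v x) \<le> (1 + e * c + e\<^sup>2 * 0) * lp_norm 1 x" .
    qed
  qed
qed

lemma log_norm_inf_le:
  assumes B: "B \<in> carrier_mat m m" and m: "0 < m"
    and c: "\<And>i. i < m \<Longrightarrow> B $$ (i, i) + (\<Sum>j\<in>{..<m} - {i}. \<bar>B $$ (i, j)\<bar>) \<le> c"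
  shows "log_norm (lp_norm Orderings.top) B \<le> c"
proof (rule lp_inf.log_norm_le[OF B m, of _ 0])
  show "\<forall>\<^sub>F e in at_right 0. \<forall>x\<in>carrier_vec m.
      lp_norm Orderings.top ((1\<^sub>m m + e \<cdot>\<^sub>m B) *\<^sub>v x) \<le> (1 + e * c + e\<^sup>2 * 0) * lp_norm Orderings.top x"
    using eventually_diagonal_nonneg[of m B]
  proof eventually_elim
    case (elim e)
    have row: "(\<Sum>j<m. \<bar>(if i = j then 1 else 0) + e * B $$ (i, j)\<bar>) \<le> 1 + e * c" if "i < m" for i
      using elim c[OF that] that by (simp add: sum_abs_one_plus)
    \<comment> \<open>A bound on the maximum norm must itself be nonnegative; row 0, which exists
      because 0 < m, provides this.\<close>
    have nn: "0 \<le> 1 + e * c"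
      by (rule order_trans[OF _ row[OF m]]) (simp add: sum_nonneg)
    show ?case
    proof
      fix x :: "real vec" assume x: "x \<in> carrier_vec m"
      have "\<bar>((1\<^sub>m m + e \<cdot>\<^sub>m B) *\<^sub>v x) $ i\<bar> \<le> (1 + e * c) * lp_norm Orderings.top x" if i: "i < m" for i
      proof -
        have "\<bar>((1\<^sub>m m + e \<cdot>\<^sub>m B) *\<^sub>v x) $ i\<bar> =
            \<bar>\<Sum>j<m. ((if i = j then 1 else 0) + e * B $$ (i, j)) * x $ j\<bar>"
          by (simp only: one_plus_smult_mult_vec_index[OF B x i])
        also have "\<dots> \<le> (\<Sum>j<m. \<bar>(if i = j then 1 else 0) + e * B $$ (i, j)\<bar> * lp_norm Orderings.top x)"
          using x by (intro sum_abs[THEN order_trans] sum_mono)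
            (auto simp: abs_mult intro!: mult_left_mono lp_inf.entry_le)
        also have "\<dots> \<le> (1 + e * c) * lp_norm Orderings.top x"
          unfolding sum_distrib_right[symmetric]
          using row[OF i] by (intro mult_right_mono lp_inf.nonneg)
        finally show ?thesis .
      qed
      then show "lp_norm Orderings.top ((1\<^sub>m m + e \<cdot>\<^sub>m B) *\<^sub>v x) \<le> (1 + e * c + e\<^sup>2 * 0) * lp_norm Orderings.top x"
        using B nn lp_inf.nonneg[of x] by (simp add: lp_norm_inf_le_iff del: index_mult_mat_vec)
    qed
  qed
qed

text \<open>The test vector is the j-th unit vector, whose image under I + e B is column j.\<close>

lemma log_norm_1_ge:
  assumes B: "B \<in> carrier_mat m m" and j: "j < m"
  shows "B $$ (j, j) + (\<Sum>i\<in>{..<m} - {j}. \<bar>B $$ (i, j)\<bar>) \<le> log_norm (lp_norm 1) B"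
proof (rule lp1.log_norm_ge[OF B])
  fix e :: real assume e: "0 < e"
  let ?M = "1\<^sub>m m + e \<cdot>\<^sub>m B" and ?u = "unit_vec m j :: real vec"
  have [simp]: "(\<Sum>i<m. \<bar>?u $ i\<bar>) = 1"
    using j by (simp add: unit_vec_def if_distrib[of abs] cong: if_cong)
  have "1 + e * (B $$ (j, j) + (\<Sum>i\<in>{..<m} - {j}. \<bar>B $$ (i, j)\<bar>)) =
      (1 + e * B $$ (j, j)) + (\<Sum>i\<in>{..<m} - {j}. \<bar>(if j = i then 1 else 0) + e * B $$ (i, j)\<bar>)"
    using e by (simp add: abs_mult sum_distrib_left algebra_simps)
  \<comment> \<open>Only the diagonal term changes, from a number to its absolute value, so the
    bound holds for every e > 0.\<close>
  also have "\<dots> \<le> (\<Sum>i<m. \<bar>(if j = i then 1 else 0) + e * B $$ (i, j)\<bar>)"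
    using j by (subst sum.remove[of _ j]) auto
  also have "\<dots> = lp_norm 1 (?M *\<^sub>v ?u)"
    using B j by (auto simp: lp_norm_1 intro!: sum.cong)
  also have "\<dots> \<le> induced_norm (lp_norm 1) ?M"
    using lp1.le_induced_norm[of ?M m m ?u] B by (simp add: lp_norm_1)
  finally show "1 + e * (B $$ (j, j) + (\<Sum>i\<in>{..<m} - {j}. \<bar>B $$ (i, j)\<bar>)) \<le> induced_norm (lp_norm 1) ?M" .
qed (use j in simp)

lemma log_norm_inf_ge:
  assumes B: "B \<in> carrier_mat m m" and i: "i < m"
  shows "B $$ (i, i) + (\<Sum>j\<in>{..<m} - {i}. \<bar>B $$ (i, j)\<bar>) \<le> log_norm (lp_norm Orderings.top) B"
proof (rule lp_inf.log_norm_ge[OF B])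
  fix e :: real assume e: "0 < e"
  let ?M = "1\<^sub>m m + e \<cdot>\<^sub>m B"
  \<comment> \<open>The signs of row i: at coordinate i of (I + e B) u all off-diagonal entries
    enter with their absolute value, while the diagonal entry keeps its sign.\<close>
  define u where "u = Matrix.vec m (\<lambda>j. if j = i \<or> 0 \<le> B $$ (i, j) then 1 else (-1 :: real))"
  have u: "u \<in> carrier_vec m" by (simp add: u_def)
  have "lp_norm Orderings.top u \<le> 1" by (simp add: lp_norm_inf_le_iff u_def)
  moreover have "1 \<le> lp_norm Orderings.top u" using lp_inf.entry_le[of i u] i by (simp add: u_def)
  ultimately have [simp]: "lp_norm Orderings.top u = 1" by simp
  have "1 + e * (B $$ (i, i) + (\<Sum>j\<in>{..<m} - {i}. \<bar>B $$ (i, j)\<bar>)) =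
      (1 + e * B $$ (i, i)) * u $ i +
      (\<Sum>j\<in>{..<m} - {i}. ((if i = j then 1 else 0) + e * B $$ (i, j)) * u $ j)"
    using i by (simp add: u_def distrib_left sum_distrib_left) (rule sum.cong; simp)
  also have "\<dots> = (\<Sum>j<m. ((if i = j then 1 else 0) + e * B $$ (i, j)) * u $ j)"
    using i by (subst (2) sum.remove[of _ i]) auto
  also have "\<dots> = (?M *\<^sub>v u) $ i"
    by (simp only: one_plus_smult_mult_vec_index[OF B u i])
  also have "\<dots> \<le> lp_norm Orderings.top (?M *\<^sub>v u)"
    using lp_inf.entry_le[of i "?M *\<^sub>v u"] i B by (simp del: index_mult_mat_vec)
  also have "\<dots> \<le> induced_norm (lp_norm Orderings.top) ?M"
    using lp_inf.le_induced_norm[of ?M m m u] B u by simp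
  finally show "1 + e * (B $$ (i, i) + (\<Sum>j\<in>{..<m} - {i}. \<bar>B $$ (i, j)\<bar>)) \<le>
      induced_norm (lp_norm Orderings.top) ?M" .
qed (use i in simp)

section \<open>The Euclidean log norm and quadratic forms\<close>

lemma lp_norm_2_square: "(lp_norm 2 x)\<^sup>2 = x \<bullet> x"
  by (simp add: lp_norm_2 L2_set_def sum_nonneg scalar_prod_def atLeast0LessThan power2_eq_square)

text \<open>Expand |x + e B x|^2 = |x|^2 + 2 e <x, B x> + e^2 |B x|^2. The square root halves the
  linear coefficient at the cost of a term of order e^2.\<close>

lemma log_norm_2_le:
  assumes B: "B \<in> carrier_mat m m" and m: "0 < m"
    and c: "\<And>x. x \<in> carrier_vec m \<Longrightarrow> x \<bullet> (B *\<^sub>v x) \<le> c * (x \<bullet> x)"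
  shows "log_norm (lp_norm 2) B \<le> c"
proof -
  obtain K where K: "\<And>x. x \<in> carrier_vec m \<Longrightarrow> lp_norm 2 (B *\<^sub>v x) \<le> K * lp_norm 2 x"
    using lp2.mult_mat_vec_bound[OF B] by blast
  show ?thesis
  proof (rule lp2.log_norm_le[OF B m, of _ "K\<^sup>2"])
    \<comment> \<open>The threshold 1/2 makes 1 + 2 e c positive, as well as the factor 1 + e c +
      e^2 K^2 of the final bound.\<close>
    have "\<forall>\<^sub>F e in at_right (0::real). 1 / 2 < 1 + e * c"
      by (rule order_tendstoD(1)[of _ 1]) (auto intro!: tendsto_eq_intros)
    with eventually_at_right_less[of 0]
    show "\<forall>\<^sub>F e in at_right 0. \<forall>x\<in>carrier_vec m.
      lp_norm 2 ((1\<^sub>m m + e \<cdot>\<^sub>m B) *\<^sub>v x) \<le> (1 + e * c + e\<^sup>2 * K\<^sup>2) * lp_norm 2 x"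
    proof eventually_elim
      case (elim e)
      show ?case
      proof
        fix x :: "real vec" assume x: "x \<in> carrier_vec m"
        let ?y = "B *\<^sub>v x"
        have y: "?y \<in> carrier_vec m" using B x by simp
        have "(lp_norm 2 ?y)\<^sup>2 \<le> (K * lp_norm 2 x)\<^sup>2"
          using K[OF x] lp2.nonneg by (rule power_mono)
        then have yy: "?y \<bullet> ?y \<le> K\<^sup>2 * (x \<bullet> x)"
          by (simp add: power_mult_distrib lp_norm_2_square)
        have xx: "0 \<le> x \<bullet> x" by (simp flip: lp_norm_2_square)
        have "(lp_norm 2 ((1\<^sub>m m + e \<cdot>\<^sub>m B) *\<^sub>v x))\<^sup>2 = (x + e \<cdot>\<^sub>v ?y) \<bullet> (x + e \<cdot>\<^sub>v ?y)"
          by (simp only: lp_norm_2_square one_plus_smult_mult_vec[OF B x])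
        also have "\<dots> = x \<bullet> x + 2 * e * (x \<bullet> ?y) + e\<^sup>2 * (?y \<bullet> ?y)"
          using x y comm_scalar_prod[OF y x]
          by (simp add: scalar_prod_add_distrib[of _ m] add_scalar_prod_distrib[of _ m] power2_eq_square algebra_simps)
        also have "\<dots> \<le> x \<bullet> x + 2 * e * (c * (x \<bullet> x)) + e\<^sup>2 * (K\<^sup>2 * (x \<bullet> x))"
          using c[OF x] yy elim by (intro add_mono mult_left_mono) auto
        also have "\<dots> = (1 + 2 * (e * c) + e\<^sup>2 * K\<^sup>2) * (x \<bullet> x)"
          by (simp add: algebra_simps)
        also have "\<dots> \<le> (1 + e * c + e\<^sup>2 * K\<^sup>2)\<^sup>2 * (x \<bullet> x)"
        proof (rule mult_right_mono[OF _ xx])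
          \<comment> \<open>With a = e c and b = e^2 K^2 this is (1 + a + b)^2 - (1 + 2 a +
            b).\<close>
          have "0 \<le> (e * c)\<^sup>2 + e\<^sup>2 * K\<^sup>2 * (1 + 2 * (e * c) + e\<^sup>2 * K\<^sup>2)"
          proof -
            have b: "0 \<le> e\<^sup>2 * K\<^sup>2" by simp
            then have "0 \<le> 1 + 2 * (e * c) + e\<^sup>2 * K\<^sup>2" using elim by linarith
            with b show ?thesis by (simp only: add_nonneg_nonneg mult_nonneg_nonneg zero_le_power2)
          qed
          then show "1 + 2 * (e * c) + e\<^sup>2 * K\<^sup>2 \<le> (1 + e * c + e\<^sup>2 * K\<^sup>2)\<^sup>2"
            by (simp add: power2_eq_square algebra_simps)
        qed
        also have "\<dots> = ((1 + e * c + e\<^sup>2 * K\<^sup>2) * lp_norm 2 x)\<^sup>2"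
          by (simp add: power_mult_distrib lp_norm_2_square)
        finally show "lp_norm 2 ((1\<^sub>m m + e \<cdot>\<^sub>m B) *\<^sub>v x) \<le> (1 + e * c + e\<^sup>2 * K\<^sup>2) * lp_norm 2 x"
          by (rule power2_le_imp_le) (use elim lp2.nonneg in simp)
      qed
    qed
  qed
qed

lemma scalar_prod_le_lp_norm_2:
  assumes "dim_vec x = dim_vec y"
  shows "x \<bullet> y \<le> lp_norm 2 x * lp_norm 2 y"
proof -
  have "x \<bullet> y \<le> (\<Sum>i<dim_vec y. \<bar>x $ i\<bar> * \<bar>y $ i\<bar>)"
    by (auto simp: scalar_prod_def atLeast0LessThan abs_mult[symmetric] intro!: sum_mono)
  also have "\<dots> \<le> lp_norm 2 x * lp_norm 2 y"
    using L2_set_mult_ineq[of "($) x" "($) y"] assms by (simp add: lp_norm_2)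
  finally show ?thesis .
qed

text \<open>By the Cauchy-Schwarz inequality <x, (I + e B) x> is at most the induced norm times
  |x|^2, so the Rayleigh quotient of B at x is a lower bound for the log norm.\<close>

lemma log_norm_2_ge:
  assumes B: "B \<in> carrier_mat m m" and x: "x \<in> carrier_vec m"
  shows "x \<bullet> (B *\<^sub>v x) \<le> log_norm (lp_norm 2) B * (x \<bullet> x)"
proof (cases "x = 0\<^sub>v m")
  case True then show ?thesis using B by simp
next
  case False
  then have pos: "0 < x \<bullet> x" using lp2.pos[OF x] by (simp flip: lp_norm_2_square)
  then have m: "0 < m" using x by (cases m) (auto simp: scalar_prod_def)
  have "x \<bullet> (B *\<^sub>v x) / (x \<bullet> x) \<le> log_norm (lp_norm 2) B"
  proof (rule lp2.log_norm_ge[OF B m])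
    fix e :: real assume e: "0 < e"
    let ?M = "1\<^sub>m m + e \<cdot>\<^sub>m B"
    have Mx: "?M *\<^sub>v x \<in> carrier_vec m"
      using B x by (intro mult_mat_vec_carrier[of _ m m]) auto
    have "x \<bullet> x + e * (x \<bullet> (B *\<^sub>v x)) = x \<bullet> (?M *\<^sub>v x)"
      using B x by (simp add: one_plus_smult_mult_vec scalar_prod_add_distrib[of _ m])
    also have "\<dots> \<le> lp_norm 2 x * lp_norm 2 (?M *\<^sub>v x)"
      by (rule scalar_prod_le_lp_norm_2) (use B x in auto)
    also have "\<dots> \<le> lp_norm 2 x * (induced_norm (lp_norm 2) ?M * lp_norm 2 x)"
      using lp2.le_induced_norm[of ?M m m x] B x by (intro mult_left_mono lp2.nonneg) auto
    also have "\<dots> = induced_norm (lp_norm 2) ?M * (x \<bullet> x)"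
      by (simp add: lp_norm_2_square[symmetric] power2_eq_square)
    finally show "1 + e * (x \<bullet> (B *\<^sub>v x) / (x \<bullet> x)) \<le> induced_norm (lp_norm 2) ?M"
      using pos by (simp add: field_simps)
  qed
  then show ?thesis using pos by (simp add: divide_le_eq)
qed

section \<open>Compound matrices\<close>

definition ksubsets :: "nat \<Rightarrow> nat \<Rightarrow> nat set set" where
  "ksubsets n k = {S. S \<subseteq> {..<n} \<and> card S = k}"

lemma finite_ksubsets [simp]: "finite (ksubsets n k)"
  unfolding ksubsets_def by (rule finite_subset[of _ "Pow {..<n}"]) auto

lemma ksubsetsD:
  assumes "S \<in> ksubsets n k"
  shows "S \<subseteq> {..<n}" "card S = k" "finite S"
  using assms by (auto simp: ksubsets_def intro: finite_subset)

lemma pick_less: "S \<in> ksubsets n k \<Longrightarrow> a < k \<Longrightarrow> pick S a < n"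
  using pick_in_set[of a S] ksubsetsD[of S n k] by auto

lemma bij_betw_pick:
  assumes S: "finite S"
  shows "bij_betw (pick S) {..<card S} S"
proof (rule bij_betw_imageI)
  show "inj_on (pick S) {..<card S}"
    by (rule strict_mono_on_imp_inj_on, rule strict_mono_onI) (simp add: pick_mono)
  show "pick S ` {..<card S} = S"
  proof (intro equalityI subsetI)
    fix i assume "i \<in> S"
    \<comment> \<open>The position of i in S is the number of smaller elements of S.\<close>
    moreover from this have "card {a \<in> S. a < i} < card S"
      by (intro psubset_card_mono S) auto
    ultimately show "i \<in> pick S ` {..<card S}" using pick_card_in_set[of i S] by force
  qed (auto intro: pick_in_set)
qed

text \<open>The index set that belongs to row or column number i of a k-compound; sums over rows
  become sums over \<open>ksubsets n k\<close>.\<close>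

definition nth_subset :: "nat \<Rightarrow> nat \<Rightarrow> nat \<Rightarrow> nat set" where
  "nth_subset n k i = set (increasing_seqs n k ! i)"

lemma bij_betw_nth_subset: "bij_betw (nth_subset n k) {..<n choose k} (ksubsets n k)"
proof -
  let ?S = "{I. length I = k \<and> sorted_wrt (<) I \<and> set I \<subseteq> {..<n}}"
  have "bij_betw ((!) (increasing_seqs n k)) {..<n choose k} ?S"
    by (rule bij_betw_nth) (simp_all add: set_increasing_seqs length_increasing_seqs, simp add: increasing_seqs_def)
  moreover have "bij_betw set ?S (ksubsets n k)"
  proof (rule bij_betw_imageI)
    show "inj_on set ?S"
      by (auto intro!: inj_onI strict_sorted_equal)
    show "set ` ?S = ksubsets n k"
    proof (intro equalityI subsetI)
      fix K assume "K \<in> ksubsets n k"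
      then have "sorted_list_of_set K \<in> ?S" "set (sorted_list_of_set K) = K"
        using ksubsetsD[of K n k] by auto
      then show "K \<in> set ` ?S" by (metis imageI)
    qed (auto simp: distinct_card strict_sorted_iff ksubsets_def)
  qed
  ultimately have "bij_betw (set \<circ> (!) (increasing_seqs n k)) {..<n choose k} (ksubsets n k)"
    by (rule bij_betw_trans)
  then show ?thesis by (simp add: o_def flip: nth_subset_def)
qed

lemmas sum_nth_subset = sum.reindex_bij_betw[OF bij_betw_nth_subset]

lemma nth_subset_in: "i < n choose k \<Longrightarrow> nth_subset n k i \<in> ksubsets n k"
  using bij_betwE[OF bij_betw_nth_subset] by auto

lemma nth_subset_eq_iff:
  "i < n choose k \<Longrightarrow> j < n choose k \<Longrightarrow> nth_subset n k i = nth_subset n k j \<longleftrightarrow> i = j"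
  using bij_betw_imp_inj_on[OF bij_betw_nth_subset] by (auto simp: inj_on_def)

section \<open>Minors and multiplicativity of the compound\<close>

lemma submatrix_ksubsets:
  assumes "B \<in> carrier_mat n n" "S \<in> ksubsets n k" "R \<in> ksubsets n k"
  shows "submatrix B S R = mat k k (\<lambda>(a, b). B $$ (pick S a, pick R b))"
proof -
  have "card {i. i < n \<and> i \<in> U} = k" if "U \<in> ksubsets n k" for U
  proof -
    have "{i. i < n \<and> i \<in> U} = U" using ksubsetsD[OF that] by auto
    then show ?thesis using ksubsetsD[OF that] by simp
  qed
  then show ?thesis using assms by (simp add: submatrix_def)
qed

lemma mult_compound_index:
  assumes "B \<in> carrier_mat n n" "i < n choose k" "j < n choose k"
  shows "mult_compound k B $$ (i, j) =
    Determinant.det (mat k k (\<lambda>(a, b). B $$ (pick (nth_subset n k i) a, pick (nth_subset n k j) b)))"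
  using assms submatrix_ksubsets[OF assms(1) nth_subset_in nth_subset_in]
  by (simp add: mult_compound_def length_increasing_seqs Let_def nth_subset_def)

text \<open>If the images agree, so do the increasing enumerations, and the matrix is the identity.
  Otherwise, the images having equal size, some \<open>u a\<close> is missed by \<open>v\<close>,
  and row a is zero. General \<open>u\<close> and \<open>v\<close> are allowed because the minors
  with a row and a column deleted, used for cofactors, are also of this form.\<close>

lemma det_identity_minor:
  fixes u v :: "nat \<Rightarrow> nat"
  assumes u: "strict_mono_on {..<k} u" and v: "strict_mono_on {..<k} v"
  shows "Determinant.det (mat k k (\<lambda>(a, b). if u a = v b then 1 else 0)) =
    (if u ` {..<k} = v ` {..<k} then 1 else (0::'a::idom))"
proof (cases "u ` {..<k} = v ` {..<k}")
  case True
  have sorted: "sorted_wrt (<) (map w [0..<k])" if "strict_mono_on {..<k} w" for w :: "nat \<Rightarrow> nat"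
    using that by (auto simp: sorted_wrt_iff_nth_less strict_mono_on_def)
  have "map u [0..<k] = map v [0..<k]"
    using True by (intro strict_sorted_equal sorted u v) (simp add: atLeast0LessThan)
  then have "u a = v a" if "a < k" for a using that by simp
  moreover have "v a = v b \<longleftrightarrow> a = b" if "a < k" "b < k" for a b
    using strict_mono_on_imp_inj_on[OF v] that by (auto simp: inj_on_def)
  ultimately have "mat k k (\<lambda>(a, b). if u a = v b then 1 else 0) = (1\<^sub>m k :: 'a mat)"
    by (intro eq_matI) auto
  then show ?thesis using True by simp
next
  case False
  have "card (u ` {..<k}) = card (v ` {..<k})"
    using strict_mono_on_imp_inj_on u v by (metis card_image)
  then have "\<not> u ` {..<k} \<subseteq> v ` {..<k}"
    using False card_subset_eq[of "v ` {..<k}" "u ` {..<k}"] by auto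
  then obtain a where a: "a < k" "\<And>b. b < k \<Longrightarrow> u a \<noteq> v b" by force
  let ?M = "mat k k (\<lambda>(a, b). if u a = v b then 1 else (0::'a))"
  have "Determinant.det ?M = (\<Sum>b<k. ?M $$ (a, b) * cofactor ?M a b)"
    using a(1) by (intro laplace_expansion_row) auto
  also have "\<dots> = 0" using a by (intro sum.neutral) auto
  finally show ?thesis using False by simp
qed

lemma strict_mono_on_pick: "S \<in> ksubsets n k \<Longrightarrow> strict_mono_on {..<k} (pick S)"
  by (rule strict_mono_onI) (simp add: pick_mono ksubsetsD(2))

lemma pick_image: "S \<in> ksubsets n k \<Longrightarrow> pick S ` {..<k} = S"
  using bij_betw_pick[of S] ksubsetsD[of S n k] by (simp add: bij_betw_def)

lemma mult_compound_one: "mult_compound k (1\<^sub>m n) = 1\<^sub>m (n choose k)"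
proof (rule eq_matI)
  fix i j assume "i < dim_row (1\<^sub>m (n choose k) :: real mat)" "j < dim_col (1\<^sub>m (n choose k) :: real mat)"
  then have ij: "i < n choose k" "j < n choose k" by auto
  define S R where "S = nth_subset n k i" and "R = nth_subset n k j"
  have SR: "S \<in> ksubsets n k" "R \<in> ksubsets n k" using ij nth_subset_in by (auto simp: S_def R_def)
  have "mult_compound k (1\<^sub>m n) $$ (i, j) =
      Determinant.det (mat k k (\<lambda>(a, b). if pick S a = pick R b then 1 else 0))"
    unfolding mult_compound_index[OF one_carrier_mat ij] S_def[symmetric] R_def[symmetric]
    using pick_less SR by (intro arg_cong[of _ _ Determinant.det] eq_matI) auto
  also have "\<dots> = (if S = R then 1 else 0)"
    using det_identity_minor[OF strict_mono_on_pick[OF SR(1)] strict_mono_on_pick[OF SR(2)]]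
    by (simp add: pick_image[OF SR(1)] pick_image[OF SR(2)])
  finally show "mult_compound k (1\<^sub>m n) $$ (i, j) = 1\<^sub>m (n choose k) $$ (i, j)"
    using ij nth_subset_eq_iff[OF ij] by (simp add: S_def R_def)
qed (use mult_compound_carrier[OF one_carrier_mat] in auto)

text \<open>Choosing one summand m = f a in each row a expands the determinant into a sum over maps
  f. A map that is not injective repeats a row of Y and contributes 0. The injective maps are
  grouped by their image K; those with image K are the permutations of its increasing
  enumeration.\<close>

lemma Cauchy_Binet:
  fixes X Y :: "nat \<Rightarrow> nat \<Rightarrow> 'a :: comm_ring_1"
  shows "Determinant.det (mat k k (\<lambda>(a, b). \<Sum>m<n. X a m * Y m b)) =
    (\<Sum>K\<in>ksubsets n k. Determinant.det (mat k k (\<lambda>(a, b). X a (pick K b))) *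
       Determinant.det (mat k k (\<lambda>(a, b). Y (pick K a) b)))" (is "?L = ?R")
proof -
  let ?P = "{p. p permutes {0..<k}}" and ?F = "{0..<k} \<rightarrow>\<^sub>E {..<n}"
  define D where "D f = (\<Prod>a=0..<k. X a (f a)) * Determinant.det (mat k k (\<lambda>(a, b). Y (f a) b))" for f
  have finF: "finite ?F" by (intro finite_PiE) auto
  have "?L = (\<Sum>p\<in>?P. signof p * (\<Prod>a=0..<k. \<Sum>m<n. X a m * Y m (p a)))"
    by (auto simp: Determinant.det_def permutes_in_image intro!: sum.cong prod.cong)
  also have "\<dots> = (\<Sum>p\<in>?P. signof p * (\<Sum>f\<in>?F. \<Prod>a=0..<k. X a (f a) * Y (f a) (p a)))"
    by (simp add: prod_sum_PiE)
  also have "\<dots> = (\<Sum>f\<in>?F. \<Sum>p\<in>?P. signof p * (\<Prod>a=0..<k. X a (f a) * Y (f a) (p a)))"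
    unfolding sum_distrib_left by (rule sum.swap)
  also have "\<dots> = (\<Sum>f\<in>?F. D f)"
    by (auto simp: D_def Determinant.det_def permutes_in_image prod.distrib sum_distrib_left mult_ac
        intro!: sum.cong prod.cong)
  also have "\<dots> = (\<Sum>f\<in>{f\<in>?F. inj_on f {0..<k}}. D f)"
  proof (rule sum.mono_neutral_right[OF finF])
    show "\<forall>f\<in>?F - {f\<in>?F. inj_on f {0..<k}}. D f = 0"
    proof
      fix f assume "f \<in> ?F - {f\<in>?F. inj_on f {0..<k}}"
      then obtain a b where ab: "a < k" "b < k" "a \<noteq> b" "f a = f b" by (auto simp: inj_on_def)
      then have "Determinant.det (mat k k (\<lambda>(a, b). Y (f a) b)) = 0"
        by (intro det_identical_rows[of _ k a b]) (auto intro!: eq_vecI)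
      then show "D f = 0" by (simp add: D_def)
    qed
  qed auto
  also have "\<dots> = (\<Sum>K\<in>ksubsets n k. \<Sum>f\<in>{f\<in>{f\<in>?F. inj_on f {0..<k}}. f ` {0..<k} = K}. D f)"
    by (intro sum.group[symmetric] finite_ksubsets finite_subset[OF _ finF])
      (auto simp: ksubsets_def card_image)
  also have "\<dots> = ?R"
  proof (rule sum.cong[OF refl])
    fix K assume K: "K \<in> ksubsets n k"
    have cK: "card K = k" and KD: "K \<subseteq> {..<n}" and fK: "finite K" using ksubsetsD[OF K] by auto
    let ?X = "mat k k (\<lambda>(a, b). X a (pick K b))" and ?Y = "mat k k (\<lambda>(a, b). Y (pick K a) b)"
    let ?G = "{f\<in>{f\<in>?F. inj_on f {0..<k}}. f ` {0..<k} = K}"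
    have bK: "bij_betw (pick K) {0..<k} K" using bij_betw_pick[OF fK] cK by (simp add: atLeast0LessThan)
    have pos: "card {a \<in> K. a < pick K i} = i" if "i < k" for i using card_pick[of i K] that cK by simp
    have pp: "p i < k" if "p permutes {0..<k}" "i < k" for p i using permutes_in_image[OF that(1), of i] that(2) by simp
    \<comment> \<open>The permutation of f sends a to the position of f a in K. It is the identity
      outside {0..<k}, as \<open>permutes\<close> requires, while \<open>restrict\<close> makes the
      composite extensional, as the function space requires.\<close>
    have "(\<Sum>f\<in>?G. D f) = (\<Sum>p\<in>?P. D (restrict (pick K \<circ> p) {0..<k}))"
    proof (rule sum.reindex_bij_witness[where
          j = "\<lambda>f i. if i < k then card {a\<in>K. a < f i} else i" and
          i = "\<lambda>p. restrict (pick K \<circ> p) {0..<k}"], goal_cases)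
      case (1 f)
      then have fK: "f i \<in> K" if "i < k" for i using that by auto
      show ?case
      proof
        fix i show "restrict (pick K \<circ> (\<lambda>i. if i < k then card {a \<in> K. a < f i} else i)) {0..<k} i = f i"
          using 1 fK pick_card_in_set by (auto simp: PiE_iff extensional_def)
      qed
    next
      case (2 f)
      let ?p = "\<lambda>i. if i < k then card {a\<in>K. a < f i} else i"
      have ff: "f i \<in> K" if "i < k" for i using that 2 by auto
      have lt: "card {a\<in>K. a < f i} < k" if "i < k" for i
        using ff[OF that] fK cK by (metis (no_types, lifting) mem_Collect_eq order_less_irrefl psubsetI psubset_card_mono subsetI)
      define p where "p = ?p"
      have "inj_on p {0..<k}"
      proof (rule inj_onI)
        fix i j assume ij: "i \<in> {0..<k}" "j \<in> {0..<k}" "p i = p j"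
        have "f i = pick K (p i)" using ij(1) pick_card_in_set[OF ff] by (simp add: p_def)
        also have "\<dots> = pick K (p j)" by (simp only: ij(3))
        also have "\<dots> = f j" using ij(2) pick_card_in_set[OF ff] by (simp add: p_def)
        finally show "i = j" using 2 ij(1,2) by (auto dest: inj_onD)
      qed
      moreover from this have "p ` {0..<k} = {0..<k}"
        by (rule endo_inj_surj[rotated 2]) (use lt in \<open>auto simp: p_def\<close>)
      ultimately have "p permutes {0..<k}"
        by (intro bij_imp_permutes) (auto simp: bij_betw_def p_def)
      then show ?case by (simp add: p_def)
    next
      case (3 p)
      show ?case
      proof
        fix i show "(if i < k then card {a \<in> K. a < restrict (pick K \<circ> p) {0..<k} i} else i) = p i"
          using 3 pos pp permutes_not_in[of p "{0..<k}" i] by auto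
      qed
    next
      case (4 p)
      then have "bij_betw (pick K \<circ> p) {0..<k} K" by (auto intro: bij_betw_trans[OF _ bK] permutes_imp_bij)
      then show ?case using KD by (auto simp: bij_betw_def)
    next
      case (5 f)
      then have fK: "f i \<in> K" if "i < k" for i using that by auto
      have "restrict (pick K \<circ> (\<lambda>i. if i < k then card {a \<in> K. a < f i} else i)) {0..<k} = f"
      proof
        fix i show "restrict (pick K \<circ> (\<lambda>i. if i < k then card {a \<in> K. a < f i} else i)) {0..<k} i = f i"
          using 5 fK pick_card_in_set by (auto simp: PiE_iff extensional_def)
      qed
      then show ?case by simp
    qed
    \<comment> \<open>Sorting the rows of the Y-minor costs the sign of p, and the sum over p that
      remains is the Leibniz expansion of the X-minor.\<close>
    also have "\<dots> = (\<Sum>p\<in>?P. signof p * (\<Prod>a=0..<k. X a (pick K (p a))) * Determinant.det ?Y)"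
    proof (rule sum.cong[OF refl])
      fix p assume "p \<in> ?P"
      then have p: "p permutes {0..<k}" by simp
      have "Determinant.det (mat k k (\<lambda>(a, b). Y (restrict (pick K \<circ> p) {0..<k} a) b)) =
          Determinant.det (mat k k (\<lambda>(a, b). ?Y $$ (p a, b)))"
        using pp[OF p] by (intro arg_cong[of _ _ Determinant.det] eq_matI) auto
      also have "\<dots> = signof p * Determinant.det ?Y"
        by (rule det_permute_rows[OF _ p]) simp
      finally show "D (restrict (pick K \<circ> p) {0..<k}) =
          signof p * (\<Prod>a=0..<k. X a (pick K (p a))) * Determinant.det ?Y"
        by (simp add: D_def mult_ac)
    qed
    also have "\<dots> = Determinant.det ?X * Determinant.det ?Y"
      by (auto simp: Determinant.det_def permutes_in_image sum_distrib_right pp intro!: sum.cong prod.cong)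
    finally show "(\<Sum>f\<in>?G. D f) = Determinant.det ?X * Determinant.det ?Y" .
  qed
  finally show ?thesis .
qed

lemma mult_compound_mult:
  assumes X: "X \<in> carrier_mat n n" and Y: "Y \<in> carrier_mat n n"
  shows "mult_compound k (X * Y) = mult_compound k X * mult_compound k Y"
proof (rule eq_matI)
  have c: "mult_compound k X \<in> carrier_mat (n choose k) (n choose k)"
    "mult_compound k Y \<in> carrier_mat (n choose k) (n choose k)"
    "mult_compound k (X * Y) \<in> carrier_mat (n choose k) (n choose k)"
    using X Y by (auto intro: mult_compound_carrier)
  then show "dim_row (mult_compound k (X * Y)) = dim_row (mult_compound k X * mult_compound k Y)"
    "dim_col (mult_compound k (X * Y)) = dim_col (mult_compound k X * mult_compound k Y)" by auto
  fix i j assume "i < dim_row (mult_compound k X * mult_compound k Y)"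
    "j < dim_col (mult_compound k X * mult_compound k Y)"
  then have ij: "i < n choose k" "j < n choose k" using c by auto
  define S R where "S = nth_subset n k i" and "R = nth_subset n k j"
  have SR: "S \<in> ksubsets n k" "R \<in> ksubsets n k" using ij nth_subset_in by (auto simp: S_def R_def)
  have "mult_compound k (X * Y) $$ (i, j) =
      Determinant.det (mat k k (\<lambda>(a, b). (X * Y) $$ (pick S a, pick R b)))"
    using ij X Y by (simp add: mult_compound_index[of _ n] S_def R_def)
  also have "\<dots> = Determinant.det (mat k k (\<lambda>(a, b). \<Sum>m<n. X $$ (pick S a, m) * Y $$ (m, pick R b)))"
    using SR X Y pick_less
    by (intro arg_cong[of _ _ Determinant.det] eq_matI) (auto simp: scalar_prod_def atLeast0LessThan)
  also have "\<dots> = (\<Sum>K\<in>ksubsets n k. Determinant.det (mat k k (\<lambda>(a, b). X $$ (pick S a, pick K b))) *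
       Determinant.det (mat k k (\<lambda>(a, b). Y $$ (pick K a, pick R b))))"
    by (rule Cauchy_Binet)
  also have "\<dots> = (\<Sum>l<n choose k. mult_compound k X $$ (i, l) * mult_compound k Y $$ (l, j))"
    using ij X Y
    by (simp add: sum_nth_subset[symmetric] mult_compound_index[of _ n] S_def R_def)
  also have "\<dots> = (mult_compound k X * mult_compound k Y) $$ (i, j)"
    using c ij by (simp add: scalar_prod_def atLeast0LessThan)
  finally show "mult_compound k (X * Y) $$ (i, j) = (mult_compound k X * mult_compound k Y) $$ (i, j)" .
qed

section \<open>Jacobi's formula and the entries of the additive compound\<close>

lemma has_field_derivative_det:
  fixes P Q :: "nat \<Rightarrow> nat \<Rightarrow> real"
  shows "((\<lambda>e. Determinant.det (mat k k (\<lambda>(a, b). P a b + e * Q a b))) has_field_derivative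
    (\<Sum>a<k. \<Sum>b<k. Q a b * cofactor (mat k k (\<lambda>(a, b). P a b)) a b)) (at 0)"
proof -
  let ?S = "{p. p permutes {0..<k}}"
  \<comment> \<open>The product rule in the Leibniz expansion gives the sum over a of the
    determinants of P with row a replaced by row a of Q. Expanding along that row leaves cofactors
    of P.\<close>
  let ?R = "\<lambda>a. mat k k (\<lambda>(c, b). if c = a then Q a b else P c b)"
  have pp: "p i < k" if "p permutes {0..<k}" "i < k" for p i using permutes_in_image[OF that(1), of i] that(2) by simp
  have det: "Determinant.det (mat k k (\<lambda>(a, b). P a b + e * Q a b)) =
      (\<Sum>p\<in>?S. signof p * (\<Prod>a=0..<k. P a (p a) + e * Q a (p a)))" for e
    by (auto simp: Determinant.det_def pp intro!: sum.cong prod.cong)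
  have "((\<lambda>e. \<Sum>p\<in>?S. signof p * (\<Prod>a=0..<k. P a (p a) + e * Q a (p a))) has_field_derivative
      (\<Sum>p\<in>?S. signof p * (\<Sum>a=0..<k. Q a (p a) * (\<Prod>c\<in>{0..<k}-{a}. P c (p c) + 0 * Q c (p c))))) (at 0)"
    by (intro DERIV_sum DERIV_cmult has_field_derivative_prod) (auto intro!: derivative_eq_intros)
  moreover have "(\<Sum>p\<in>?S. signof p * (\<Sum>a=0..<k. Q a (p a) * (\<Prod>c\<in>{0..<k}-{a}. P c (p c) + 0 * Q c (p c)))) =
      (\<Sum>a<k. \<Sum>b<k. Q a b * cofactor (mat k k (\<lambda>(a, b). P a b)) a b)"
  proof -
    have "(\<Sum>p\<in>?S. signof p * (\<Sum>a=0..<k. Q a (p a) * (\<Prod>c\<in>{0..<k}-{a}. P c (p c) + 0 * Q c (p c)))) =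
        (\<Sum>a=0..<k. \<Sum>p\<in>?S. signof p * (Q a (p a) * (\<Prod>c\<in>{0..<k}-{a}. P c (p c))))"
      unfolding sum_distrib_left by (subst sum.swap) simp
    also have "\<dots> = (\<Sum>a=0..<k. Determinant.det (?R a))"
    proof (intro sum.cong refl)
      fix a assume a: "a \<in> {0..<k}"
      have "(\<Prod>c=0..<k. ?R a $$ (c, p c)) = Q a (p a) * (\<Prod>c\<in>{0..<k}-{a}. P c (p c))"
        if "p permutes {0..<k}" for p
        using a pp[OF that] by (simp add: prod.remove[of _ a])
      then show "(\<Sum>p\<in>?S. signof p * (Q a (p a) * (\<Prod>c\<in>{0..<k}-{a}. P c (p c)))) =
          Determinant.det (?R a)"
        by (auto simp: Determinant.det_def intro!: sum.cong)
    qed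
    also have "\<dots> = (\<Sum>a<k. \<Sum>b<k. Q a b * cofactor (mat k k (\<lambda>(a, b). P a b)) a b)"
      unfolding atLeast0LessThan
    proof (intro sum.cong refl)
      fix a assume a: "a \<in> {..<k}"
      have "mat_delete (?R a) a b = mat_delete (mat k k (\<lambda>(a, b). P a b)) a b" for b
        by (rule eq_matI) (auto simp: mat_delete_def)
      then show "Determinant.det (?R a) = (\<Sum>b<k. Q a b * cofactor (mat k k (\<lambda>(a, b). P a b)) a b)"
        using a laplace_expansion_row[of "?R a" k a] by (simp add: cofactor_def)
    qed
    finally show ?thesis .
  qed
  ultimately show ?thesis by (simp add: det)
qed

text \<open>For i in S this is the sign of removing e_i from the wedge product of the e_a, a in S,
  in increasing order, and equally of inserting it into the product for S - {i}.\<close>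

definition position_sign :: "nat \<Rightarrow> nat set \<Rightarrow> real" where
  "position_sign i S = (- 1) ^ card {a\<in>S. a < i}"

(* The entry of the k-additive compound of C in row S and column R; it is the matrix entry of
   the operator \<Sum> C i j a_i^* a_j on the exterior algebra, for creation operators a_i^*. *)
definition additive_entry :: "(nat \<Rightarrow> nat \<Rightarrow> real) \<Rightarrow> nat set \<Rightarrow> nat set \<Rightarrow> real" where
  "additive_entry C S R = (\<Sum>i\<in>S. \<Sum>j\<in>R.
     if S - {i} = R - {j} then position_sign i S * position_sign j R * C i j else 0)"

text \<open>Deleting row a and column b leaves an identity minor for the two reduced index sets. The
  factor (-1)^(a+b) splits into the two position signs because a elements of S lie below
  \<open>pick S a\<close>, and likewise for b and R.\<close>

lemma cofactor_identity_minor: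
  assumes S: "S \<in> ksubsets n k" and R: "R \<in> ksubsets n k" and a: "a < k" and b: "b < k"
  shows "cofactor (mat k k (\<lambda>(a, b). if pick S a = pick R b then 1 else (0::real))) a b =
    (if S - {pick S a} = R - {pick R b}
     then position_sign (pick S a) S * position_sign (pick R b) R else 0)"
proof -
  have mono: "strict_mono_on {..<k - 1} (\<lambda>x. pick U (insert_index c x))"
    if "U \<in> ksubsets n k" for U c
    using ksubsetsD(2)[OF that]
    by (intro strict_mono_onI pick_mono) (auto simp: insert_index_def)
  have image: "(\<lambda>x. pick U (insert_index c x)) ` {..<k - 1} = U - {pick U c}"
    if U: "U \<in> ksubsets n k" and c: "c < k" for U c
  proof -
    have "insert_index c ` {..<k - 1} = {..<k} - {c}"
    proof (intro equalityI subsetI)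
      fix x assume "x \<in> {..<k} - {c}"
      then have "x = insert_index c (delete_index c x)" "delete_index c x < k - 1"
        using c by (auto simp: insert_index_def delete_index_def)
      then show "x \<in> insert_index c ` {..<k - 1}" by blast
    qed (use c in \<open>auto simp: insert_index_def\<close>)
    moreover have "inj_on (pick U) {..<k}" using strict_mono_on_imp_inj_on[OF strict_mono_on_pick[OF U]] .
    ultimately show ?thesis
      using c pick_image[OF U] by (simp add: image_image[symmetric] inj_on_image_set_diff[of _ "{..<k}"])
  qed
  have "mat_delete (mat k k (\<lambda>(a, b). if pick S a = pick R b then 1 else (0::real))) a b =
      mat (k - 1) (k - 1) (\<lambda>(x, y). if pick S (insert_index a x) = pick R (insert_index b y) then 1 else 0)"
    by (rule eq_matI) (auto simp: mat_delete_def insert_index_def)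
  then show ?thesis
    using det_identity_minor[OF mono[OF S, of a] mono[OF R, of b], where 'a = real]
      card_pick[of a S] card_pick[of b R] a b ksubsetsD[OF S] ksubsetsD[OF R]
    by (simp add: cofactor_def image[OF S a] image[OF R b] position_sign_def power_add del: One_nat_def)
qed

lemma add_compound_has_derivative:
  assumes A: "A \<in> carrier_mat n n" and ij: "i < n choose k" "j < n choose k"
  shows "((\<lambda>e. mult_compound k (1\<^sub>m n + e \<cdot>\<^sub>m A) $$ (i, j)) has_field_derivative
    add_compound k A $$ (i, j)) (at 0)"
proof -
  have "mult_compound k (1\<^sub>m n + 0 \<cdot>\<^sub>m A) \<in> carrier_mat (n choose k) (n choose k)"
    using A by (intro mult_compound_carrier) auto
  then have "add_compound k A $$ (i, j) = deriv (\<lambda>e. mult_compound k (1\<^sub>m n + e \<cdot>\<^sub>m A) $$ (i, j)) 0"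
    using A ij by (simp add: add_compound_def Let_def)
  then show ?thesis
    using mult_compound_entry_differentiable[OF A ij, of 0]
    by (simp add: field_differentiable_derivI)
qed

text \<open>Jacobi's formula, with a minor of the identity for P and a minor of A for Q, followed by
  a change of summation from positions to elements.\<close>

lemma add_compound_index:
  assumes A: "A \<in> carrier_mat n n" and ij: "i < n choose k" "j < n choose k"
  shows "add_compound k A $$ (i, j) =
    additive_entry (\<lambda>a b. A $$ (a, b)) (nth_subset n k i) (nth_subset n k j)"
proof -
  define S R where "S = nth_subset n k i" and "R = nth_subset n k j"
  have SR: "S \<in> ksubsets n k" "R \<in> ksubsets n k" using ij nth_subset_in by (auto simp: S_def R_def)
  have bS: "bij_betw (pick S) {..<k} S" and bR: "bij_betw (pick R) {..<k} R"
    using bij_betw_pick[of S] bij_betw_pick[of R] ksubsetsD[OF SR(1)] ksubsetsD[OF SR(2)] by simp_all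
  have "mult_compound k (1\<^sub>m n + e \<cdot>\<^sub>m A) $$ (i, j) = Determinant.det (mat k k (\<lambda>(a, b).
      (if pick S a = pick R b then 1 else 0) + e * A $$ (pick S a, pick R b)))" for e
  proof -
    have "1\<^sub>m n + e \<cdot>\<^sub>m A \<in> carrier_mat n n" using A by simp
    from mult_compound_index[OF this ij] show ?thesis
      unfolding S_def[symmetric] R_def[symmetric]
      using SR[THEN pick_less] A by (auto intro!: arg_cong[of _ _ Determinant.det] eq_matI)
  qed
  then have "((\<lambda>e. mult_compound k (1\<^sub>m n + e \<cdot>\<^sub>m A) $$ (i, j)) has_field_derivative
      (\<Sum>a<k. \<Sum>b<k. A $$ (pick S a, pick R b) *
        cofactor (mat k k (\<lambda>(a, b). if pick S a = pick R b then 1 else 0)) a b)) (at 0)"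
    by (simp add: has_field_derivative_det)
  then have "add_compound k A $$ (i, j) = (\<Sum>a<k. \<Sum>b<k. A $$ (pick S a, pick R b) *
        cofactor (mat k k (\<lambda>(a, b). if pick S a = pick R b then 1 else 0)) a b)"
    by (rule DERIV_unique[OF add_compound_has_derivative[OF A ij]])
  also have "\<dots> = (\<Sum>a<k. \<Sum>b<k. if S - {pick S a} = R - {pick R b}
      then position_sign (pick S a) S * position_sign (pick R b) R * A $$ (pick S a, pick R b) else 0)"
    by (intro sum.cong refl) (simp add: cofactor_identity_minor[OF SR])
  also have "\<dots> = additive_entry (\<lambda>a b. A $$ (a, b)) S R"
    by (simp add: additive_entry_def sum.reindex_bij_betw[OF bS, symmetric]
        sum.reindex_bij_betw[OF bR, symmetric])
  finally show ?thesis by (simp add: S_def R_def)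
qed

section \<open>Conjugation by T\<close>

lemma the_mat_inverse_eqI:
  assumes X: "X \<in> carrier_mat m m" and Y: "Y \<in> carrier_mat m m"
    and XY: "X * Y = 1\<^sub>m m" and YX: "Y * X = 1\<^sub>m m"
  shows "the (mat_inverse (X :: real mat)) = Y"
proof -
  let ?Z = "the (mat_inverse X)"
  have "invertible_mat X"
    using X Y XY YX by (auto simp: invertible_mat_def inverts_mat_def)
  note Z = mat_inverse_invertible[OF X this]
  have "?Z = ?Z * (X * Y)" using Z XY by simp
  also have "\<dots> = (?Z * X) * Y" using Z X Y by (simp add: assoc_mult_mat[symmetric])
  also have "\<dots> = Y" using Z Y by simp
  finally show ?thesis .
qed

lemma conjugate_one_plus:
  fixes A :: "real mat"
  assumes A: "A \<in> carrier_mat n n" and T: "T \<in> carrier_mat n n" and S: "S \<in> carrier_mat n n"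
    and TS: "T * S = 1\<^sub>m n"
  shows "T * (1\<^sub>m n + e \<cdot>\<^sub>m A) * S = 1\<^sub>m n + e \<cdot>\<^sub>m (T * A * S)"
proof -
  have "T * (1\<^sub>m n + e \<cdot>\<^sub>m A) = T + e \<cdot>\<^sub>m (T * A)"
    using mult_add_distrib_mat[OF T one_carrier_mat, of "e \<cdot>\<^sub>m A"] mult_smult_distrib[OF T A] A T by simp
  also have "\<dots> * S = 1\<^sub>m n + e \<cdot>\<^sub>m (T * A * S)"
    using add_mult_distrib_mat[OF T _ S, of "e \<cdot>\<^sub>m (T * A)"] mult_smult_assoc_mat[OF _ S, of "T * A" n] A T TS
    by simp
  finally show ?thesis .
qed

text \<open>Multiplicativity applied to T (I + e A) S = I + e T A S leaves e only in the middle
  factor of a product of compounds. Differentiating at 0 therefore passes through the two constant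
  outer factors.\<close>

lemma add_compound_conjugate:
  assumes A: "A \<in> carrier_mat n n" and T: "T \<in> carrier_mat n n" and S: "S \<in> carrier_mat n n"
    and TS: "T * S = 1\<^sub>m n" and ST: "S * T = 1\<^sub>m n"
  shows "mult_compound k T * add_compound k A * the (mat_inverse (mult_compound k T)) =
    add_compound k (T * A * S)"
proof -
  let ?m = "n choose k"
  note c = mult_compound_carrier[OF T, of k] mult_compound_carrier[OF S, of k] add_compound_carrier[OF A, of k]
  have TAS: "T * A * S \<in> carrier_mat n n" using T S A by simp
  have inv: "the (mat_inverse (mult_compound k T)) = mult_compound k S"
    using c T S TS ST mult_compound_one
    by (intro the_mat_inverse_eqI[of _ ?m]) (simp_all add: mult_compound_mult[symmetric, of _ n])
  have entry: "(mult_compound k T * M * mult_compound k S) $$ (i, j) =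
      (\<Sum>b<?m. \<Sum>a<?m. mult_compound k T $$ (i, a) * M $$ (a, b) * mult_compound k S $$ (b, j))"
    if "M \<in> carrier_mat ?m ?m" "i < ?m" "j < ?m" for M i j
    using c that
    by (simp add: scalar_prod_def atLeast0LessThan sum_distrib_left mult.assoc) (rule sum.swap)
  show ?thesis
    unfolding inv
  proof (rule eq_matI)
    fix i j assume "i < dim_row (add_compound k (T * A * S))" "j < dim_col (add_compound k (T * A * S))"
    then have ij: "i < ?m" "j < ?m" using add_compound_carrier[OF TAS, of k] by auto
    have I: "1\<^sub>m n + e \<cdot>\<^sub>m A \<in> carrier_mat n n" for e using A by simp
    have "mult_compound k (1\<^sub>m n + e \<cdot>\<^sub>m (T * A * S)) =
        mult_compound k T * mult_compound k (1\<^sub>m n + e \<cdot>\<^sub>m A) * mult_compound k S" for e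
      unfolding conjugate_one_plus[OF A T S TS, symmetric]
      using T S I by (simp add: mult_compound_mult[of _ n])
    then have "((\<lambda>e. mult_compound k (1\<^sub>m n + e \<cdot>\<^sub>m (T * A * S)) $$ (i, j)) has_field_derivative
        (\<Sum>b<?m. \<Sum>a<?m. mult_compound k T $$ (i, a) * add_compound k A $$ (a, b) *
          mult_compound k S $$ (b, j))) (at 0)"
      using entry[OF mult_compound_carrier[OF I] ij]
      by (auto intro!: DERIV_sum DERIV_cmult DERIV_cmult_right add_compound_has_derivative[OF A])
    from DERIV_unique[OF this add_compound_has_derivative[OF TAS ij]]
    show "(mult_compound k T * add_compound k A * mult_compound k S) $$ (i, j) =
        add_compound k (T * A * S) $$ (i, j)"
      by (simp add: entry[OF c(3) ij])
  qed (use c add_compound_carrier[OF TAS, of k] in auto)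
qed

lemma trace_conjugate:
  assumes A: "A \<in> carrier_mat n n" and T: "T \<in> carrier_mat n n" and S: "S \<in> carrier_mat n n"
    and ST: "S * T = 1\<^sub>m n"
  shows "trace_mat (T * A * S) = trace_mat A"
proof -
  have comm: "trace_mat (X * Y) = trace_mat (Y * X)"
    if "X \<in> carrier_mat n n" "Y \<in> carrier_mat n n" for X Y
    using that sum.swap[of "\<lambda>i j. X $$ (i, j) * Y $$ (j, i)" "{..<n}" "{..<n}"]
    by (simp add: trace_mat_def scalar_prod_def atLeast0LessThan mult.commute)
  have "trace_mat (T * A * S) = trace_mat (S * (T * A))"
    using A T S by (intro comm) auto
  also have "S * (T * A) = A" using A T S ST by (simp add: assoc_mult_mat[symmetric, of _ n n])
  finally show ?thesis .
qed

section \<open>The entries of the additive compound\<close>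

lemma additive_entry_diagonal:
  assumes "finite S"
  shows "additive_entry C S S = (\<Sum>i\<in>S. C i i)"
  unfolding additive_entry_def
proof (rule sum.cong[OF refl])
  fix i assume i: "i \<in> S"
  have "(\<Sum>j\<in>S. if S - {i} = S - {j} then position_sign i S * position_sign j S * C i j else 0) =
      (\<Sum>j\<in>S. if i = j then C i i else 0)"
    using i by (intro sum.cong refl) (auto simp: position_sign_def simp flip: power_add mult_2)
  then show "(\<Sum>j\<in>S. if S - {i} = S - {j} then position_sign i S * position_sign j S * C i j else 0) = C i i"
    using i assms by simp
qed

lemma additive_entry_transpose: "additive_entry C S R = additive_entry (\<lambda>i j. C j i) R S"
  unfolding additive_entry_def by (subst sum.swap) (auto intro!: sum.cong)

lemma abs_position_sign [simp]: "\<bar>position_sign i S\<bar> = 1"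
  by (simp add: position_sign_def power_abs)

text \<open>The set S can only be \<open>insert i (R - {j})\<close>. For i in R nothing is left: i =
  j would give S = R, and for i \<noteq> j the element i lies in R - {j} but not in S - {i}.\<close>

lemma sum_neighbours_le:
  fixes c :: real
  assumes c: "0 \<le> c" and j: "j \<in> R"
  shows "(\<Sum>S\<in>ksubsets n k - {R}. if i \<in> S \<and> S - {i} = R - {j} then c else 0) \<le> (if i \<in> R then 0 else c)"
proof (cases "i \<in> R")
  case True
  have "\<not> (i \<in> S \<and> S - {i} = R - {j})" if "S \<noteq> R" for S using that True j by blast
  then show ?thesis using c True by (subst sum.neutral) auto
next
  case False
  have "(\<Sum>S\<in>ksubsets n k - {R}. if i \<in> S \<and> S - {i} = R - {j} then c else 0) \<le>
      (\<Sum>S\<in>ksubsets n k - {R}. if S = insert i (R - {j}) then c else 0)"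
    using c by (intro sum_mono) auto
  also have "\<dots> \<le> c" using c by simp
  finally show ?thesis using False by simp
qed

lemma sum_abs_additive_entry_le:
  assumes R: "R \<in> ksubsets n k"
  shows "(\<Sum>S\<in>ksubsets n k - {R}. \<bar>additive_entry C S R\<bar>) \<le> (\<Sum>j\<in>R. \<Sum>i\<in>{..<n} - R. \<bar>C i j\<bar>)"
proof -
  have entry: "\<bar>additive_entry C S R\<bar> \<le>
      (\<Sum>j\<in>R. \<Sum>i<n. if i \<in> S \<and> S - {i} = R - {j} then \<bar>C i j\<bar> else 0)" if "S \<in> ksubsets n k" for S
  proof -
    have "\<bar>additive_entry C S R\<bar> \<le> (\<Sum>i\<in>S. \<Sum>j\<in>R. if S - {i} = R - {j} then \<bar>C i j\<bar> else 0)"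
      unfolding additive_entry_def
      by (intro order_trans[OF sum_abs] sum_mono) (auto simp: abs_mult)
    also have "\<dots> = (\<Sum>j\<in>R. \<Sum>i\<in>S. if S - {i} = R - {j} then \<bar>C i j\<bar> else 0)"
      by (rule sum.swap)
    also have "\<dots> = (\<Sum>j\<in>R. \<Sum>i<n. if i \<in> S \<and> S - {i} = R - {j} then \<bar>C i j\<bar> else 0)"
      using ksubsetsD(1)[OF that] by (intro sum.cong refl sum.mono_neutral_cong_left) auto
    finally show ?thesis .
  qed
  have "(\<Sum>S\<in>ksubsets n k - {R}. \<bar>additive_entry C S R\<bar>) \<le>
      (\<Sum>S\<in>ksubsets n k - {R}. \<Sum>j\<in>R. \<Sum>i<n. if i \<in> S \<and> S - {i} = R - {j} then \<bar>C i j\<bar> else 0)"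
    by (intro sum_mono entry) auto
  also have "\<dots> = (\<Sum>j\<in>R. \<Sum>i<n. \<Sum>S\<in>ksubsets n k - {R}. if i \<in> S \<and> S - {i} = R - {j} then \<bar>C i j\<bar> else 0)"
    by (subst sum.swap, intro sum.cong refl, rule sum.swap)
  also have "\<dots> \<le> (\<Sum>j\<in>R. \<Sum>i<n. if i \<in> R then 0 else \<bar>C i j\<bar>)"
    by (rule sum_mono, rule sum_mono, rule sum_neighbours_le) auto
  also have "\<dots> = (\<Sum>j\<in>R. \<Sum>i\<in>{..<n} - R. \<bar>C i j\<bar>)"
    by (intro sum.cong refl sum.mono_neutral_cong_right) auto
  finally show ?thesis .
qed

lemma additive_entry_column_bound:
  assumes R: "R \<in> ksubsets n k"
    and \<mu>: "\<And>i. i < n \<Longrightarrow> - C i i + (\<Sum>j\<in>{..<n} - {i}. \<bar>C i j\<bar>) \<le> \<mu>"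
  shows "additive_entry C R R + (\<Sum>S\<in>ksubsets n k - {R}. \<bar>additive_entry C S R\<bar>) \<le>
    (\<Sum>i<n. C i i) + (real n - real k) * \<mu>"
proof -
  note RD = ksubsetsD[OF R]
  have "(\<Sum>S\<in>ksubsets n k - {R}. \<bar>additive_entry C S R\<bar>) \<le> (\<Sum>i\<in>{..<n} - R. \<Sum>j\<in>R. \<bar>C i j\<bar>)"
    using sum_abs_additive_entry_le[OF R, of C] by (subst sum.swap)
  \<comment> \<open>The columns in R avoid i, so this part of row i is covered by the off-diagonal
    sum in the hypothesis.\<close>
  also have "\<dots> \<le> (\<Sum>i\<in>{..<n} - R. \<mu> + C i i)"
  proof (rule sum_mono)
    fix i assume i: "i \<in> {..<n} - R"
    have "(\<Sum>j\<in>R. \<bar>C i j\<bar>) \<le> (\<Sum>j\<in>{..<n} - {i}. \<bar>C i j\<bar>)"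
      using i RD by (intro sum_mono2) auto
    then show "(\<Sum>j\<in>R. \<bar>C i j\<bar>) \<le> \<mu> + C i i" using \<mu>[of i] i by simp
  qed
  \<comment> \<open>There are n - k indices outside R; the diagonal sum over R that is subtracted
    here cancels against \<open>additive_entry C R R\<close>.\<close>
  also have "\<dots> = (real n - real k) * \<mu> + ((\<Sum>i<n. C i i) - (\<Sum>i\<in>R. C i i))"
    using RD card_mono[of "{..<n}" R] by (simp add: sum.distrib card_Diff_subset of_nat_diff sum_diff)
  finally show ?thesis by (simp add: additive_entry_diagonal RD)
qed

section \<open>Anticommutation and the quadratic form\<close>

lemma position_sign_insert:
  assumes "finite S" "j \<notin> S"
  shows "position_sign i (insert j S) = (if j < i then - position_sign i S else position_sign i S)"
proof -
  have "{a \<in> insert j S. a < i} = (if j < i then insert j {a\<in>S. a < i} else {a\<in>S. a < i})" by auto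
  then show ?thesis using assms by (simp add: position_sign_def)
qed

lemma position_sign_square [simp]: "position_sign i S * position_sign i S = 1"
  by (simp add: position_sign_def flip: power_add mult_2)

(* The anticommutation relation a_i^* a_j + a_j a_i^* = \<delta>_ij, as an identity of quadratic forms. *)
lemma anticommutation:
  fixes x :: "nat set \<Rightarrow> real"
  assumes ij: "i < n" "j < n"
  shows "(\<Sum>S\<in>ksubsets n k. \<Sum>R\<in>ksubsets n k. if i \<in> S \<and> j \<in> R \<and> S - {i} = R - {j}
        then position_sign i S * position_sign j R * x S * x R else 0) +
    (\<Sum>D\<in>ksubsets n (Suc k). if i \<in> D \<and> j \<in> D
        then position_sign i D * position_sign j D * x (D - {i}) * x (D - {j}) else 0) =
    (if i = j then \<Sum>S\<in>ksubsets n k. (x S)\<^sup>2 else 0)" (is "?q + ?w = _")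
proof -
  let ?K = "ksubsets n k" and ?move = "\<lambda>S. insert j (S - {i})"
  \<comment> \<open>The sets in which i can be exchanged for j; \<open>?move S\<close> is then the
    only R that pairs with S.\<close>
  let ?A = "{S\<in>?K. i \<in> S \<and> j \<notin> S - {i}}"
  have moveK: "?move S \<in> ?K" if "S \<in> ?A" for S
    using that ij ksubsetsD(3)[of S n k] card_Suc_Diff1[of S i] by (auto simp: ksubsets_def card_insert_if)
  have "?q = (\<Sum>S\<in>?K. if i \<in> S \<and> j \<notin> S - {i}
      then position_sign i S * position_sign j (?move S) * x S * x (?move S) else 0)"
  proof (rule sum.cong[OF refl])
    fix S assume S: "S \<in> ?K"
    have iff: "i \<in> S \<and> j \<in> R \<and> S - {i} = R - {j} \<longleftrightarrow> (i \<in> S \<and> j \<notin> S - {i}) \<and> R = ?move S" for R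
      using S by auto
    show "(\<Sum>R\<in>?K. if i \<in> S \<and> j \<in> R \<and> S - {i} = R - {j}
        then position_sign i S * position_sign j R * x S * x R else 0) =
      (if i \<in> S \<and> j \<notin> S - {i} then position_sign i S * position_sign j (?move S) * x S * x (?move S) else 0)"
    proof (cases "i \<in> S \<and> j \<notin> S - {i}")
      case True
      then show ?thesis
        unfolding iff using moveK[of S] S by simp
    qed (simp only: iff simp_thms if_False sum.neutral_const)
  qed
  also have "\<dots> = (\<Sum>S\<in>?A. position_sign i S * position_sign j (?move S) * x S * x (?move S))"
    by (rule sum.inter_filter[symmetric]) simp
  finally have q: "?q = (\<Sum>S\<in>?A. position_sign i S * position_sign j (?move S) * x S * x (?move S))" .
  let ?B = "{S\<in>?K. j \<notin> S \<and> i \<in> insert j S}"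
  have "?w = (\<Sum>D\<in>{D\<in>ksubsets n (Suc k). i \<in> D \<and> j \<in> D}.
      position_sign i D * position_sign j D * x (D - {i}) * x (D - {j}))"
    by (rule sum.inter_filter[symmetric]) simp
  \<comment> \<open>Writing D = insert j S brings the second sum down to sets of size k.\<close>
  also have "\<dots> = (\<Sum>S\<in>?B.
      position_sign i (insert j S) * position_sign j (insert j S) * x (insert j S - {i}) * x S)"
  proof (rule sum.reindex_bij_witness[of _ "insert j" "\<lambda>D. D - {j}"])
    fix D assume D: "D \<in> {D\<in>ksubsets n (Suc k). i \<in> D \<and> j \<in> D}"
    then show "D - {j} \<in> ?B" using ksubsetsD(3)[of D n "Suc k"] by (auto simp: ksubsets_def)
    from D have [simp]: "insert j D = D" by auto
    show "insert j (D - {j}) = D" by simp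
    show "position_sign i (insert j (D - {j})) * position_sign j (insert j (D - {j})) *
        x (insert j (D - {j}) - {i}) * x (D - {j}) =
      position_sign i D * position_sign j D * x (D - {i}) * x (D - {j})" by simp
  next
    fix S assume S: "S \<in> ?B"
    then show "insert j S - {j} = S" by auto
    show "insert j S \<in> {D\<in>ksubsets n (Suc k). i \<in> D \<and> j \<in> D}"
      using S ij ksubsetsD(3)[of S n k] by (auto simp: ksubsets_def)
  qed
  finally have w: "?w = (\<Sum>S\<in>?B.
      position_sign i (insert j S) * position_sign j (insert j S) * x (insert j S - {i}) * x S)" .
  show ?thesis
  proof (cases "i = j")
    case True
    \<comment> \<open>For i = j the first sum collects the sets that contain i and the second those
      that do not.\<close>
    have "?q = (\<Sum>S\<in>{S\<in>?K. i \<in> S}. (x S)\<^sup>2)"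
      unfolding q using True by (intro sum.cong) (auto simp: insert_absorb power2_eq_square)
    moreover have "?w = (\<Sum>S\<in>{S\<in>?K. i \<notin> S}. (x S)\<^sup>2)"
      unfolding w using True by (intro sum.cong) (auto simp: power2_eq_square)
    moreover have "(\<Sum>S\<in>?K. (x S)\<^sup>2) = (\<Sum>S\<in>{S\<in>?K. i \<in> S} \<union> {S\<in>?K. i \<notin> S}. (x S)\<^sup>2)"
      by (intro sum.cong) auto
    ultimately show ?thesis
      using True by (subst (asm) sum.union_disjoint) auto
  next
    case False
    \<comment> \<open>For i \<noteq> j both sums run over the sets that contain i but not j, and
      they cancel term by term.\<close>
    have "?w = (\<Sum>S\<in>?A. - (position_sign i S * position_sign j (?move S) * x S * x (?move S)))"
      unfolding w
    proof (rule sum.cong)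
      fix S assume "S \<in> ?A"
      then have S: "finite S" "i \<in> S" "j \<notin> S" using False ksubsetsD(3)[of S n k] by auto
      \<comment> \<open>Inserting j flips the sign of i exactly if j < i, and removing i flips the
        sign of j exactly if i < j. One of the two happens, which yields the minus sign.\<close>
      have "position_sign j S = position_sign j (insert i (S - {i}))" using S by (simp add: insert_absorb)
      also have "\<dots> = (if i < j then - position_sign j (S - {i}) else position_sign j (S - {i}))"
        using S by (intro position_sign_insert) auto
      finally have "position_sign i (insert j S) * position_sign j (insert j S) =
          - (position_sign i S * position_sign j (?move S))"
        using S False by (auto simp: position_sign_insert)
      moreover have "insert j S - {i} = ?move S" using False by auto
      ultimately show "position_sign i (insert j S) * position_sign j (insert j S) * x (insert j S - {i}) * x S =
          - (position_sign i S * position_sign j (?move S) * x S * x (?move S))" by simp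
    qed (use False in auto)
    then show ?thesis using False by (simp add: q sum_negf)
  qed
qed

lemma additive_entry_quadratic_form_le:
  fixes x :: "nat set \<Rightarrow> real"
  assumes \<mu>: "\<And>y :: nat \<Rightarrow> real. - (\<Sum>i<n. \<Sum>j<n. C i j * (y i * y j)) \<le> \<mu> * (\<Sum>i<n. (y i)\<^sup>2)"
  shows "(\<Sum>S\<in>ksubsets n k. \<Sum>R\<in>ksubsets n k. x S * additive_entry C S R * x R) \<le>
    ((\<Sum>i<n. C i i) + (real n - real k) * \<mu>) * (\<Sum>S\<in>ksubsets n k. (x S)\<^sup>2)"
proof -
  let ?K = "ksubsets n k" and ?K' = "ksubsets n (Suc k)"
  define X where "X = (\<Sum>S\<in>?K. (x S)\<^sup>2)"
  \<comment> \<open>In operator terms \<open>q i j\<close> is <x, a_i^* a_j x>, \<open>y D i\<close>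
    is the D-coordinate of a_i^* x, and \<open>w i j\<close> is <a_i^* x, a_j^* x>.\<close>
  define q where "q i j = (\<Sum>S\<in>?K. \<Sum>R\<in>?K. if i \<in> S \<and> j \<in> R \<and> S - {i} = R - {j}
        then position_sign i S * position_sign j R * x S * x R else 0)" for i j
  define y where "y D i = (if i \<in> D then position_sign i D * x (D - {i}) else 0)" for D i
  define w where "w i j = (\<Sum>D\<in>?K'. y D i * y D j)" for i j
  have car: "q i j + w i j = (if i = j then X else 0)" if "i < n" "j < n" for i j
  proof -
    have "w i j = (\<Sum>D\<in>?K'. if i \<in> D \<and> j \<in> D
        then position_sign i D * position_sign j D * x (D - {i}) * x (D - {j}) else 0)"
      unfolding w_def y_def by (intro sum.cong) auto
    then show ?thesis using anticommutation[OF that, where k = k and x = x] by (simp add: q_def X_def)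
  qed
  have "(\<Sum>S\<in>?K. \<Sum>R\<in>?K. x S * additive_entry C S R * x R) = (\<Sum>i<n. \<Sum>j<n. C i j * q i j)"
  proof -
    have "(\<Sum>S\<in>?K. \<Sum>R\<in>?K. x S * additive_entry C S R * x R) =
      (\<Sum>S\<in>?K. \<Sum>R\<in>?K. \<Sum>i<n. \<Sum>j<n. C i j * (if i \<in> S \<and> j \<in> R \<and> S - {i} = R - {j}
        then position_sign i S * position_sign j R * x S * x R else 0))"
    proof (intro sum.cong refl)
      fix S R assume SR: "S \<in> ?K" "R \<in> ?K"
      have "additive_entry C S R = (\<Sum>i<n. \<Sum>j<n. if i \<in> S \<and> j \<in> R \<and> S - {i} = R - {j}
        then position_sign i S * position_sign j R * C i j else 0)"
        unfolding additive_entry_def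
      proof (rule sum.mono_neutral_cong_left)
        fix i assume "i \<in> S"
        then show "(\<Sum>j\<in>R. if S - {i} = R - {j} then position_sign i S * position_sign j R * C i j else 0) =
          (\<Sum>j<n. if i \<in> S \<and> j \<in> R \<and> S - {i} = R - {j}
            then position_sign i S * position_sign j R * C i j else 0)"
          using ksubsetsD(1)[OF SR(2)] by (intro sum.mono_neutral_cong_left) auto
      qed (use ksubsetsD(1)[OF SR(1)] in auto)
      then show "x S * additive_entry C S R * x R =
        (\<Sum>i<n. \<Sum>j<n. C i j * (if i \<in> S \<and> j \<in> R \<and> S - {i} = R - {j}
          then position_sign i S * position_sign j R * x S * x R else 0))"
        by (auto simp: sum_distrib_left sum_distrib_right intro!: sum.cong)
    qed
    also have "\<dots> = (\<Sum>S\<in>?K. \<Sum>i<n. \<Sum>R\<in>?K. \<Sum>j<n. C i j * (if i \<in> S \<and> j \<in> R \<and> S - {i} = R - {j}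
        then position_sign i S * position_sign j R * x S * x R else 0))"
      by (intro sum.cong refl, rule sum.swap)
    also have "\<dots> = (\<Sum>S\<in>?K. \<Sum>i<n. \<Sum>j<n. \<Sum>R\<in>?K. C i j * (if i \<in> S \<and> j \<in> R \<and> S - {i} = R - {j}
        then position_sign i S * position_sign j R * x S * x R else 0))"
      by (intro sum.cong refl, rule sum.swap)
    also have "\<dots> = (\<Sum>i<n. \<Sum>S\<in>?K. \<Sum>j<n. \<Sum>R\<in>?K. C i j * (if i \<in> S \<and> j \<in> R \<and> S - {i} = R - {j}
        then position_sign i S * position_sign j R * x S * x R else 0))"
      by (rule sum.swap)
    also have "\<dots> = (\<Sum>i<n. \<Sum>j<n. \<Sum>S\<in>?K. \<Sum>R\<in>?K. C i j * (if i \<in> S \<and> j \<in> R \<and> S - {i} = R - {j}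
        then position_sign i S * position_sign j R * x S * x R else 0))"
      by (intro sum.cong refl, rule sum.swap)
    finally show ?thesis by (simp only: q_def sum_distrib_left)
  qed
  also have "\<dots> = (\<Sum>i<n. \<Sum>j<n. C i j * (if i = j then X else 0) - C i j * w i j)"
    by (intro sum.cong refl) (simp add: car[symmetric] algebra_simps)
  also have "\<dots> = (\<Sum>i<n. C i i) * X - (\<Sum>i<n. \<Sum>j<n. C i j * w i j)"
    by (simp add: sum_subtractf sum_distrib_right if_distrib[of "(*) _"] cong: if_cong)
  \<comment> \<open>For each D separately this is the quadratic form of C at the vector
    \<open>y D\<close>, to which the hypothesis applies.\<close>
  also have "(\<Sum>i<n. \<Sum>j<n. C i j * w i j) = (\<Sum>D\<in>?K'. \<Sum>i<n. \<Sum>j<n. C i j * (y D i * y D j))"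
  proof -
    have "(\<Sum>i<n. \<Sum>j<n. C i j * w i j) = (\<Sum>i<n. \<Sum>D\<in>?K'. \<Sum>j<n. C i j * (y D i * y D j))"
      unfolding w_def sum_distrib_left by (intro sum.cong refl, rule sum.swap)
    then show ?thesis by (simp only: sum.swap[of _ "?K'"])
  qed
  also have "(\<Sum>i<n. C i i) * X - (\<Sum>D\<in>?K'. \<Sum>i<n. \<Sum>j<n. C i j * (y D i * y D j)) \<le>
      (\<Sum>i<n. C i i) * X + (\<Sum>D\<in>?K'. \<mu> * (\<Sum>i<n. (y D i)\<^sup>2))"
    using sum_mono[of ?K', OF \<mu>[of "y _"]] by (simp add: sum_negf)
  also have "(\<Sum>D\<in>?K'. \<mu> * (\<Sum>i<n. (y D i)\<^sup>2)) = \<mu> * (\<Sum>i<n. w i i)"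
    unfolding sum_distrib_left[symmetric] w_def by (subst sum.swap) (simp add: power2_eq_square)
  also have "(\<Sum>i<n. w i i) = (\<Sum>i<n. X - q i i)"
    by (intro sum.cong refl) (use car in force)
  \<comment> \<open>The sum of the a_i^* a_i is the number operator, which acts as multiplication by
    k in degree k; so the \<open>q i i\<close> add up to k X.\<close>
  also have "\<dots> = (real n - real k) * X"
  proof -
    have "q i i = (\<Sum>S\<in>?K. if i \<in> S then (x S)\<^sup>2 else 0)" for i
      unfolding q_def
    proof (rule sum.cong[OF refl])
      fix S assume S: "S \<in> ?K"
      have "i \<in> S \<and> i \<in> R \<and> S - {i} = R - {i} \<longleftrightarrow> i \<in> S \<and> R = S" for R by auto
      then show "(\<Sum>R\<in>?K. if i \<in> S \<and> i \<in> R \<and> S - {i} = R - {i}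
        then position_sign i S * position_sign i R * x S * x R else 0) = (if i \<in> S then (x S)\<^sup>2 else 0)"
        using S by (cases "i \<in> S") (auto simp: power2_eq_square)
    qed
    then have "(\<Sum>i<n. q i i) = (\<Sum>S\<in>?K. \<Sum>i<n. if i \<in> S then (x S)\<^sup>2 else 0)"
      by (simp only:) (rule sum.swap)
    also have "\<dots> = (\<Sum>S\<in>?K. real k * (x S)\<^sup>2)"
    proof (rule sum.cong[OF refl])
      fix S assume "S \<in> ?K"
      then have "{..<n} \<inter> S = S" "card S = k" using ksubsetsD[of S n k] by auto
      then show "(\<Sum>i<n. if i \<in> S then (x S)\<^sup>2 else 0) = real k * (x S)\<^sup>2"
        by (simp add: sum.inter_restrict[symmetric])
    qed
    finally show ?thesis by (simp add: sum_subtractf X_def sum_distrib_left[symmetric] algebra_simps)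
  qed
  finally show ?thesis by (simp add: X_def algebra_simps)
qed

section \<open>The bound\<close>

lemma conjugate_exponent:
  fixes p q :: ennreal
  assumes "inverse p + inverse q = 1"
  shows "p = 1 \<Longrightarrow> q = Orderings.top" "p = 2 \<Longrightarrow> q = 2" "p = Orderings.top \<Longrightarrow> q = 1"
proof -
  show "q = Orderings.top" if "p = 1"
  proof -
    have "1 + inverse q = 1 + 0" using assms that by simp
    then have "inverse q = 0" unfolding ennreal_add_left_cancel by simp
    then show ?thesis by simp
  qed
  \<comment> \<open>Reciprocals are compared through real representatives, which requires ruling out
    0 and infinity for q first.\<close>
  have inv: "q = r" if "inverse q = inverse r" "0 < r" "r < Orderings.top" for r
  proof -
    have "q \<noteq> 0" "q \<noteq> Orderings.top"
      using that by (auto simp: ennreal_inverse_eq_0_iff ennreal_inverse_eq_top_iff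
          eq_commute[of Orderings.top])
    then obtain s where s: "q = ennreal s" "0 < s" by (cases q) (auto simp: ennreal_eq_0_iff)
    from that obtain t where t: "r = ennreal t" "0 < t" by (cases r) (auto simp: ennreal_less_zero_iff)
    show ?thesis using that(1) s t by (simp add: inverse_ennreal)
  qed
  show "q = 2" if "p = 2"
  proof (rule inv)
    have half: "inverse (2::ennreal) = ennreal (1 / 2)"
      using inverse_ennreal[of 2] by (simp add: inverse_eq_divide)
    have "inverse 2 + inverse (2::ennreal) = ennreal (1 / 2) + ennreal (1 / 2)"
      by (simp only: half)
    also have "\<dots> = ennreal (1 / 2 + 1 / 2)" by (rule ennreal_plus[symmetric]) simp_all
    also have "\<dots> = 1" by simp
    finally have "inverse 2 + inverse q = inverse 2 + inverse (2::ennreal)" using assms that by simp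
    then show "inverse q = inverse 2" unfolding ennreal_add_left_cancel by simp
  qed auto
  show "q = 1" if "p = Orderings.top"
    using assms that by (intro inv) auto
qed

text \<open>This is the case T = I. The exponent passes from p to its conjugate because a column sum
  of the compound regroups into parts of rows of C, and a row sum of the compound into parts of
  columns of C.\<close>

lemma log_norm_add_compound_le:
  assumes C: "C \<in> carrier_mat n n" and k: "k \<le> n"
    and p: "p \<in> {1, 2, \<infinity>}" and pq: "inverse p + inverse q = 1"
  shows "log_norm (lp_norm p) (add_compound k C) \<le>
    trace_mat C + (real n - real k) * log_norm (lp_norm q) (- C)" (is "_ \<le> ?t")
proof -
  let ?m = "n choose k" and ?M = "add_compound k C" and ?s = "nth_subset n k" and ?K = "ksubsets n k"
  let ?c = "\<lambda>i j. C $$ (i, j)"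
  have M: "?M \<in> carrier_mat ?m ?m" using C by (rule add_compound_carrier)
  have m: "0 < ?m" using k by simp
  have mC: "- C \<in> carrier_mat n n" using C by simp
  have tr: "trace_mat C = (\<Sum>i<n. C $$ (i, i))" using C by (simp add: trace_mat_def)
  have off_diagonal: "(\<Sum>i\<in>{..<?m} - {j}. g (?s i)) = (\<Sum>S\<in>?K - {?s j}. g S)" if "j < ?m" for g :: "nat set \<Rightarrow> real" and j
    using that nth_subset_in[OF that] sum_nth_subset[where g = g] by (simp add: sum_diff1)
  consider "p = 1" | "p = 2" | "p = Orderings.top" using p by auto
  then show ?thesis
  proof cases
    case 1
    have \<mu>: "- ?c i i + (\<Sum>j\<in>{..<n} - {i}. \<bar>?c i j\<bar>) \<le> log_norm (lp_norm q) (- C)" if "i < n" for i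
      using log_norm_inf_ge[OF mC that] C that conjugate_exponent(1)[OF pq 1] by simp
    have "log_norm (lp_norm 1) ?M \<le> ?t"
    proof (rule log_norm_1_le[OF M m])
      fix j assume j: "j < ?m"
      have "?M $$ (j, j) + (\<Sum>i\<in>{..<?m} - {j}. \<bar>?M $$ (i, j)\<bar>) =
          additive_entry ?c (?s j) (?s j) + (\<Sum>S\<in>?K - {?s j}. \<bar>additive_entry ?c S (?s j)\<bar>)"
        using off_diagonal[OF j, symmetric] j C by (simp add: add_compound_index[OF C])
      also have "\<dots> \<le> ?t"
        using additive_entry_column_bound[OF nth_subset_in[OF j], of ?c] \<mu> by (simp add: tr)
      finally show "?M $$ (j, j) + (\<Sum>i\<in>{..<?m} - {j}. \<bar>?M $$ (i, j)\<bar>) \<le> ?t" .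
    qed
    then show ?thesis using 1 by simp
  next
    case 2
    have q: "q = 2" using conjugate_exponent(2)[OF pq 2] .
    have \<mu>: "- (\<Sum>i<n. \<Sum>j<n. ?c i j * (y i * y j)) \<le> log_norm (lp_norm q) (- C) * (\<Sum>i<n. (y i)\<^sup>2)" for y
      using log_norm_2_ge[OF mC, of "Matrix.vec n y"] C
      by (simp add: q scalar_prod_def atLeast0LessThan power2_eq_square sum_negf sum_distrib_left mult_ac)
    have "log_norm (lp_norm 2) ?M \<le> ?t"
    proof (rule log_norm_2_le[OF M m])
      fix x :: "real vec" assume x: "x \<in> carrier_vec ?m"
      \<comment> \<open>The coordinates of x, relabelled by index sets.\<close>
      define f where "f S = x $ inv_into {..<?m} ?s S" for S
      have f: "x $ i = f (?s i)" if "i < ?m" for i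
        using that bij_betw_imp_inj_on[OF bij_betw_nth_subset, of n k] by (simp add: f_def)
      have "x \<bullet> (?M *\<^sub>v x) = (\<Sum>i<?m. \<Sum>j<?m. f (?s i) * additive_entry ?c (?s i) (?s j) * f (?s j))"
        using x M by (simp add: scalar_prod_def atLeast0LessThan sum_distrib_left f add_compound_index[OF C] mult.assoc)
      also have "\<dots> = (\<Sum>S\<in>?K. \<Sum>R\<in>?K. f S * additive_entry ?c S R * f R)"
        by (simp only: sum_nth_subset[where g = "\<lambda>R. f (?s _) * additive_entry ?c (?s _) R * f R"]
            sum_nth_subset[where g = "\<lambda>S. \<Sum>R\<in>?K. f S * additive_entry ?c S R * f R"])
      also have "\<dots> \<le> ?t * (\<Sum>S\<in>?K. (f S)\<^sup>2)"
        unfolding tr using \<mu> by (rule additive_entry_quadratic_form_le)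
      also have "(\<Sum>S\<in>?K. (f S)\<^sup>2) = x \<bullet> x"
        using x by (simp add: sum_nth_subset[symmetric] scalar_prod_def atLeast0LessThan f power2_eq_square)
      finally show "x \<bullet> (?M *\<^sub>v x) \<le> ?t * (x \<bullet> x)" .
    qed
    then show ?thesis using 2 by simp
  next
    case 3
    have \<mu>: "- ?c i i + (\<Sum>j\<in>{..<n} - {i}. \<bar>?c j i\<bar>) \<le> log_norm (lp_norm q) (- C)" if "i < n" for i
      using log_norm_1_ge[OF mC that] C that conjugate_exponent(3)[OF pq 3] by simp
    have "log_norm (lp_norm Orderings.top) ?M \<le> ?t"
    proof (rule log_norm_inf_le[OF M m])
      fix i assume i: "i < ?m"
      have "?M $$ (i, i) + (\<Sum>j\<in>{..<?m} - {i}. \<bar>?M $$ (i, j)\<bar>) =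
          additive_entry ?c (?s i) (?s i) + (\<Sum>S\<in>?K - {?s i}. \<bar>additive_entry ?c (?s i) S\<bar>)"
        using off_diagonal[OF i, symmetric] i C by (simp add: add_compound_index[OF C])
      \<comment> \<open>A row of the compound of C is a column of the compound of its transpose, so
        the column bound applies again.\<close>
      also have "\<dots> = additive_entry (\<lambda>i j. ?c j i) (?s i) (?s i) +
          (\<Sum>S\<in>?K - {?s i}. \<bar>additive_entry (\<lambda>i j. ?c j i) S (?s i)\<bar>)"
        by (simp only: additive_entry_transpose[of ?c "?s i"])
      also have "\<dots> \<le> ?t"
        using additive_entry_column_bound[OF nth_subset_in[OF i], of "\<lambda>i j. ?c j i"] \<mu> by (simp add: tr)
      finally show "?M $$ (i, i) + (\<Sum>j\<in>{..<?m} - {i}. \<bar>?M $$ (i, j)\<bar>) \<le> ?t" .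
    qed
    then show ?thesis using 3 by simp
  qed
qed

theorem theorem17:
  fixes n k :: nat and A T :: "real mat" and p q :: ennreal
  assumes "n \<ge> 1"
    and "A \<in> carrier_mat n n"
    and "k \<in> {1..n}"
    and "p \<in> {1, 2, \<infinity>}"
    and "inverse p + inverse q = 1"
    and "T \<in> carrier_mat n n"
    and "invertible_mat T"
  shows "scaled_log_norm p (mult_compound k T) (add_compound k A)
           \<le> trace_mat A + (real n - real k) * scaled_log_norm q T (- A)"
proof -
  let ?S = "the (mat_inverse T)"
  note A = assms(2) and T = assms(6)
  note S = mat_inverse_invertible[OF T assms(7)]
  have TAS: "T * A * ?S \<in> carrier_mat n n" using A T S(1) by simp
  have neg: "T * (- A) * ?S = - (T * A * ?S)" using A T S(1) by simp
  \<comment> \<open>Both log norms and the trace are rewritten in terms of the single matrix T A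
    T^-1.\<close>
  show ?thesis
    unfolding scaled_log_norm_def add_compound_conjugate[OF A T S] neg
      trace_conjugate[OF A T S(1,3), symmetric]
    using log_norm_add_compound_le[OF TAS _ assms(4,5), of k] assms(3) by simp
qed

end
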